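(* Let $t$ and $s$ be terms in the language of strong quasi-MV* algebras. Then $\mathbb{SQMV^\ast}\models t\approx s$ if and only if $\mathbf{S^*}\models t\approx s$.
   Context: A quasi-MV* algebra is an algebra $\mathbf{A}=\langle A;\oplus,-,{}^{+},{}^{-},0,1\rangle$ of type $\langle 2,1,1,1,0,0\rangle$ (the unary operations ${}^+,{}^-$ are written as superscripts and bind more tightly than $-$, which binds more tightly than $\oplus$; $-1$ denotes $-(1)$) such that for all $x,y,z\in A$: (1) $x\oplus y=y\oplus x$; (2) $(1\oplus x)\oplus(y\oplus(1\oplus z))=((1\oplus x)\oplus y)\oplus(1\oplus z)$; (3) $(x\oplus 1)\oplus 1=1$; (4) $(x\oplus y)\oplus 0=x\oplus y$; (5) $x^{+}\oplus 0=(x\oplus 0)^{+}=1\oplus(-1\oplus x)$ and $x^{-}\oplus 0=(x\oplus 0)^{-}=-1\oplus(1\oplus x)$; (6) $x\oplus y=(x^{+}\oplus y^{+})\oplus(x^{-}\oplus y^{-})$; (7) $0=-0$; (8) $x\oplus(-x)=0$; (9) $-(x\oplus y)=(-x)\oplus(-y)$; (10) $-(-x)=x$; (11) $(-x\oplus(x\oplus y))^{+}=-x^{+}\oplus(x^{+}\oplus y^{+})$; (12) $x\vee y=y\vee x$; (13) $x\vee(y\vee z)=(x\vee y)\vee z$; (14) $x\oplus(y\vee z)=(x\oplus y)\vee(x\oplus z)$; where $x\vee y:=(x^{+}\oplus(-x^{+}\oplus y^{+})^{+})\oplus(x^{-}\oplus(-x^{-}\oplus y^{-})^{+})$. A strong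 quasi-MV* algebra is a quasi-MV* algebra satisfying $x^+=x^+\oplus 0$ and $x^-=x^-\oplus 0$ for all $x$; $\mathbb{SQMV^\ast}$ denotes the variety of strong quasi-MV* algebras. Terms in the language of strong quasi-MV* algebras are built from variables and the constants $0,1$ using $\oplus,-,{}^+,{}^-$; for an algebra or class $K$, $K\models t\approx s$ means $t$ and $s$ take equal values under every assignment of the variables in every algebra of $K$. The square standard strong quasi-MV* algebra $\mathbf{S^*}$ has universe $S^*=[-1,1]\times[-1,1]\subseteq\mathbb{R}^2$ with $\langle a,b\rangle\oplus\langle c,d\rangle=\langle\max\{-1,\min\{1,a+c\}\},0\rangle$, $-\langle a,b\rangle=\langle -a,-b\rangle$, $\langle a,b\rangle^+=\langle\max\{0,a\},0\rangle$, $\langle a,b\rangle^-=\langle\min\{0,a\},0\rangle$, $0=\langle 0,0\rangle$, $1=\langle 1,0\rangle$. *)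

theory Defs
  imports Complex_Main "HOL-Library.Infinite_Typeclass"
begin

datatype tm = Var nat | Zero | One | Oplus tm tm | Neg tm | Pl tm | Mn tm

record 'a qalg =
  car :: "'a set"
  opl :: "'a \<Rightarrow> 'a \<Rightarrow> 'a"
  ng  :: "'a \<Rightarrow> 'a"
  pls :: "'a \<Rightarrow> 'a"
  mns :: "'a \<Rightarrow> 'a"
  zr  :: "'a"
  on  :: "'a"

definition qjoin :: "('a, 'b) qalg_scheme \<Rightarrow> 'a \<Rightarrow> 'a \<Rightarrow> 'a" where
  "qjoin A x y =
     opl A (opl A (pls A x) (pls A (opl A (ng A (pls A x)) (pls A y))))
           (opl A (mns A x) (pls A (opl A (ng A (mns A x)) (mns A y))))"

definition is_qmv :: "('a, 'b) qalg_scheme \<Rightarrow> bool" where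
  "is_qmv A \<longleftrightarrow>
    zr A \<in> car A \<and> on A \<in> car A \<and>
    (\<forall>x\<in>car A. \<forall>y\<in>car A. opl A x y \<in> car A) \<and>
    (\<forall>x\<in>car A. ng A x \<in> car A \<and> pls A x \<in> car A \<and> mns A x \<in> car A) \<and>
    (\<forall>x\<in>car A. \<forall>y\<in>car A. \<forall>z\<in>car A.
      opl A x y = opl A y x \<and>
      opl A (opl A (on A) x) (opl A y (opl A (on A) z))
        = opl A (opl A (opl A (on A) x) y) (opl A (on A) z) \<and>
      opl A (opl A x (on A)) (on A) = on A \<and>
      opl A (opl A x y) (zr A) = opl A x y \<and>
      opl A (pls A x) (zr A) = pls A (opl A x (zr A)) \<and>
      pls A (opl A x (zr A)) = opl A (on A) (opl A (ng A (on A)) x) \<and>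
      opl A (mns A x) (zr A) = mns A (opl A x (zr A)) \<and>
      mns A (opl A x (zr A)) = opl A (ng A (on A)) (opl A (on A) x) \<and>
      opl A x y = opl A (opl A (pls A x) (pls A y)) (opl A (mns A x) (mns A y)) \<and>
      zr A = ng A (zr A) \<and>
      opl A x (ng A x) = zr A \<and>
      ng A (opl A x y) = opl A (ng A x) (ng A y) \<and>
      ng A (ng A x) = x \<and>
      pls A (opl A (ng A x) (opl A x y))
        = opl A (ng A (pls A x)) (opl A (pls A x) (pls A y)) \<and>
      qjoin A x y = qjoin A y x \<and>
      qjoin A x (qjoin A y z) = qjoin A (qjoin A x y) z \<and>
      opl A x (qjoin A y z) = qjoin A (opl A x y) (opl A x z))"

definition is_sqmv :: "('a, 'b) qalg_scheme \<Rightarrow> bool" where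
  "is_sqmv A \<longleftrightarrow> is_qmv A \<and>
    (\<forall>x\<in>car A. pls A x = opl A (pls A x) (zr A) \<and> mns A x = opl A (mns A x) (zr A))"

primrec eval :: "('a, 'b) qalg_scheme \<Rightarrow> (nat \<Rightarrow> 'a) \<Rightarrow> tm \<Rightarrow> 'a" where
  "eval A \<rho> (Var n) = \<rho> n"
| "eval A \<rho> Zero = zr A"
| "eval A \<rho> One = on A"
| "eval A \<rho> (Oplus t u) = opl A (eval A \<rho> t) (eval A \<rho> u)"
| "eval A \<rho> (Neg t) = ng A (eval A \<rho> t)"
| "eval A \<rho> (Pl t) = pls A (eval A \<rho> t)"
| "eval A \<rho> (Mn t) = mns A (eval A \<rho> t)"

definition holds :: "('a, 'b) qalg_scheme \<Rightarrow> tm \<Rightarrow> tm \<Rightarrow> bool" where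
  "holds A t s \<longleftrightarrow> (\<forall>\<rho>. (\<forall>n. \<rho> n \<in> car A) \<longrightarrow> eval A \<rho> t = eval A \<rho> s)"

text \<open>Validity in the variety SQMV*, over algebras whose elements live in the
  (arbitrary, infinite) type 'a.\<close>
definition SQMV_holds :: "'a itself \<Rightarrow> tm \<Rightarrow> tm \<Rightarrow> bool" where
  "SQMV_holds (_ :: 'a itself) t s \<longleftrightarrow>
     (\<forall>A :: 'a qalg. is_sqmv A \<longrightarrow> holds A t s)"

definition clip :: "real \<Rightarrow> real" where
  "clip r = max (-1) (min 1 r)"

definition Sstar :: "(real \<times> real) qalg" where
  "Sstar = \<lparr> car = {p. -1 \<le> fst p \<and> fst p \<le> 1 \<and> -1 \<le> snd p \<and> snd p \<le> 1},
             opl = (\<lambda>p q. (clip (fst p + fst q), 0)),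
             ng = (\<lambda>p. (- fst p, - snd p)),
             pls = (\<lambda>p. (max 0 (fst p), 0)),
             mns = (\<lambda>p. (min 0 (fst p), 0)),
             zr = (0, 0),
             on = (1, 0) \<rparr>"

end

theory Submission
  imports Defs "HOL-Algebra.Free_Abelian_Groups" "HOL-Library.Countable_Set"
begin

text \<open>
  In a strong quasi-MV* algebra the positive elements \<open>x\<^sup>+\<close> form an MV-algebra with negation
  \<open>p \<mapsto> 1 \<oplus> -p\<close>, and an element of the form \<open>x \<oplus> 0\<close> is determined by the pair
  \<open>(x\<^sup>+, (-x)\<^sup>+)\<close>, on which all operations act by MV-terms. Terms built from a variable by \<open>-\<close> alone
  are settled by the second coordinate of the square algebra; for all others the theorem is thereby
  reduced to Chang's completeness theorem for MV-algebras with respect to \<open>[0,1]\<close>. For that, two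
  distinct elements are separated in a linearly ordered quotient; a linearly ordered MV-algebra is
  the unit interval of an ordered abelian group (integer part and fractional part, added with carry);
  and finitely many integer linear conditions satisfied in an ordered abelian group are satisfied in
  the reals, by Fourier-Motzkin elimination. Conversely, a counterexample in the square algebra lives
  in a countable subalgebra, which has a copy inside any infinite type.
\<close>

section \<open>MV-algebras and their linearly ordered quotients\<close>

text \<open>Associativity of \<oplus> fails in general, because sums are clipped at both ends; the
  restricted law only allows outer arguments of the form 1 \<oplus> x, and these turn out to be
  exactly the positive elements. This is why the argument runs through positive parts. A second
  obstacle is that Chang's group need not be Archimedean, so it need not embed into the reals. But
  an equation has only finitely many subterm values, and only comparisons between sums of two
  elements matter. These comparisons are pulled back to a total preorder on a free abelian group,
  where elimination works on integer coefficient vectors. It has to reproduce non-membership as well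
  as membership, since distinct values must remain distinct.\<close>

locale mv_algebra =
  fixes C :: "'a set"
    and add :: "'a \<Rightarrow> 'a \<Rightarrow> 'a" (infixl \<open>\<boxplus>\<close> 65)
    and neg :: "'a \<Rightarrow> 'a" (\<open>\<sim> _\<close> [80] 80)
    and bot :: 'a (\<open>\<^bold>0\<close>)
  assumes add_closed [simp, intro]: "x \<in> C \<Longrightarrow> y \<in> C \<Longrightarrow> x \<boxplus> y \<in> C"
    and neg_closed [simp, intro]: "x \<in> C \<Longrightarrow> \<sim> x \<in> C"
    and bot_closed [simp, intro]: "\<^bold>0 \<in> C"
    and add_assoc: "x \<in> C \<Longrightarrow> y \<in> C \<Longrightarrow> z \<in> C \<Longrightarrow> (x \<boxplus> y) \<boxplus> z = x \<boxplus> (y \<boxplus> z)"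
    and add_comm: "x \<in> C \<Longrightarrow> y \<in> C \<Longrightarrow> x \<boxplus> y = y \<boxplus> x"
    and add_bot [simp]: "x \<in> C \<Longrightarrow> x \<boxplus> \<^bold>0 = x"
    and neg_neg [simp]: "x \<in> C \<Longrightarrow> \<sim> \<sim> x = x"
    and add_top [simp]: "x \<in> C \<Longrightarrow> x \<boxplus> \<sim> \<^bold>0 = \<sim> \<^bold>0"
    and lukasiewicz: "x \<in> C \<Longrightarrow> y \<in> C \<Longrightarrow> \<sim> (\<sim> x \<boxplus> y) \<boxplus> y = \<sim> (\<sim> y \<boxplus> x) \<boxplus> x"
begin

abbreviation top :: 'a (\<open>\<^bold>1\<close>) where "\<^bold>1 \<equiv> \<sim> \<^bold>0"

definition sub :: "'a \<Rightarrow> 'a \<Rightarrow> 'a" (infixl \<open>\<boxminus>\<close> 65) where "x \<boxminus> y = \<sim> (\<sim> x \<boxplus> y)"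

definition le :: "'a \<Rightarrow> 'a \<Rightarrow> bool" (infix \<open>\<preceq>\<close> 50) where "x \<preceq> y \<longleftrightarrow> \<sim> x \<boxplus> y = \<^bold>1"

lemma sub_closed [simp, intro]: "x \<in> C \<Longrightarrow> y \<in> C \<Longrightarrow> x \<boxminus> y \<in> C"
  by (simp add: sub_def)

lemma bot_add [simp]: "x \<in> C \<Longrightarrow> \<^bold>0 \<boxplus> x = x"
  by (metis add_bot add_comm bot_closed)

lemma top_add [simp]: "x \<in> C \<Longrightarrow> \<^bold>1 \<boxplus> x = \<^bold>1"
  by (metis add_comm add_top bot_closed neg_closed)

lemma add_lcomm: "x \<in> C \<Longrightarrow> y \<in> C \<Longrightarrow> z \<in> C \<Longrightarrow> x \<boxplus> (y \<boxplus> z) = y \<boxplus> (x \<boxplus> z)"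
  by (metis add_assoc add_comm)

lemma neg_add_self [simp]: "x \<in> C \<Longrightarrow> \<sim> x \<boxplus> x = \<^bold>1"
  using lukasiewicz [of x "\<^bold>1"] by simp

lemma add_neg_self [simp]: "x \<in> C \<Longrightarrow> x \<boxplus> \<sim> x = \<^bold>1"
  using add_comm [of x "\<sim> x"] by simp

lemma sub_add_comm: "x \<in> C \<Longrightarrow> y \<in> C \<Longrightarrow> (x \<boxminus> y) \<boxplus> y = (y \<boxminus> x) \<boxplus> x"
  unfolding sub_def by (rule lukasiewicz)

lemma le_refl [simp]: "x \<in> C \<Longrightarrow> x \<preceq> x"
  by (simp add: le_def)

lemma bot_le [simp]: "x \<in> C \<Longrightarrow> \<^bold>0 \<preceq> x"
  by (simp add: le_def)

text \<open>Residuation: by associativity both sides say that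
  \<open>\<sim> x \<boxplus> y \<boxplus> z\<close> is the top element. Many inequalities below are
  read off from this adjunction.\<close>

lemma sub_le_iff: "x \<in> C \<Longrightarrow> y \<in> C \<Longrightarrow> z \<in> C \<Longrightarrow> x \<boxminus> y \<preceq> z \<longleftrightarrow> x \<preceq> y \<boxplus> z"
  by (simp add: le_def sub_def add_assoc)

lemma sub_eq_bot_iff: "x \<in> C \<Longrightarrow> y \<in> C \<Longrightarrow> x \<boxminus> y = \<^bold>0 \<longleftrightarrow> x \<preceq> y"
  unfolding le_def sub_def by (metis add_closed bot_closed neg_closed neg_neg)

text \<open>By \<open>sub_add_comm\<close> the sum equals
  \<open>(x \<boxminus> y) \<boxplus> y\<close>, and \<open>x \<boxminus> y\<close>
  vanishes.\<close>

lemma sub_add_cancel: "x \<in> C \<Longrightarrow> y \<in> C \<Longrightarrow> x \<preceq> y \<Longrightarrow> (y \<boxminus> x) \<boxplus> x = y"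
  by (metis bot_add sub_add_comm sub_eq_bot_iff)

lemma le_antisym: "x \<in> C \<Longrightarrow> y \<in> C \<Longrightarrow> x \<preceq> y \<Longrightarrow> y \<preceq> x \<Longrightarrow> x = y"
  by (metis bot_add sub_add_cancel sub_eq_bot_iff)

lemma le_bot_iff: "x \<in> C \<Longrightarrow> x \<preceq> \<^bold>0 \<longleftrightarrow> x = \<^bold>0"
  using le_antisym by auto

lemma le_add1: "x \<in> C \<Longrightarrow> y \<in> C \<Longrightarrow> x \<preceq> x \<boxplus> y"
  by (simp add: le_def flip: add_assoc)

lemma le_add2: "x \<in> C \<Longrightarrow> y \<in> C \<Longrightarrow> x \<preceq> y \<boxplus> x"
  by (metis add_comm le_add1)

lemma le_trans:
  assumes "x \<in> C" "y \<in> C" "z \<in> C" "x \<preceq> y" "y \<preceq> z"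
  shows "x \<preceq> z"
proof -
  have "z = ((z \<boxminus> y) \<boxplus> (y \<boxminus> x)) \<boxplus> x"
    using assms by (simp add: add_assoc sub_add_cancel)
  thus ?thesis
    using assms by (metis add_closed le_add2 sub_closed)
qed

lemma add_right_mono:
  assumes "x \<in> C" "y \<in> C" "z \<in> C" "x \<preceq> y"
  shows "x \<boxplus> z \<preceq> y \<boxplus> z"
proof -
  have "y \<boxplus> z = (y \<boxminus> x) \<boxplus> (x \<boxplus> z)"
    using assms by (simp add: sub_add_cancel flip: add_assoc)
  thus ?thesis
    using assms by (simp add: le_add2)
qed

lemma add_left_mono: "x \<in> C \<Longrightarrow> y \<in> C \<Longrightarrow> z \<in> C \<Longrightarrow> x \<preceq> y \<Longrightarrow> z \<boxplus> x \<preceq> z \<boxplus> y"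
  by (metis add_comm add_right_mono)

lemma neg_le_neg_iff: "x \<in> C \<Longrightarrow> y \<in> C \<Longrightarrow> \<sim> x \<preceq> \<sim> y \<longleftrightarrow> y \<preceq> x"
  by (simp add: le_def add_comm)

lemma le_add_sub: "x \<in> C \<Longrightarrow> y \<in> C \<Longrightarrow> x \<preceq> y \<boxplus> (x \<boxminus> y)"
  by (metis le_refl sub_closed sub_le_iff)

lemma sub_le: "x \<in> C \<Longrightarrow> y \<in> C \<Longrightarrow> x \<boxminus> y \<preceq> x"
  by (simp add: sub_le_iff le_add2)

lemma sub_le_neg: "x \<in> C \<Longrightarrow> y \<in> C \<Longrightarrow> x \<boxminus> y \<preceq> \<sim> y"
  by (simp add: sub_def neg_le_neg_iff le_add2)

lemma sub_mono:
  assumes "x \<in> C" "y \<in> C" "z \<in> C" "x \<preceq> y"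
  shows "x \<boxminus> z \<preceq> y \<boxminus> z"
  using assms by (meson add_closed le_add_sub le_trans sub_closed sub_le_iff)

text \<open>Together with \<open>le_add2\<close> and \<open>sub_add_comm\<close> this identifies
  \<open>(x \<boxminus> y) \<boxplus> y\<close> as the join of \<open>x\<close> and
  \<open>y\<close>; it is the least-upper-bound half.\<close>

lemma sub_add_le:
  assumes "x \<in> C" "y \<in> C" "z \<in> C" "x \<preceq> z" "y \<preceq> z"
  shows "(x \<boxminus> y) \<boxplus> y \<preceq> z"
  using assms by (metis add_right_mono sub_add_cancel sub_closed sub_mono)

text \<open>The hypothesis says that the sum is not truncated. The result is
  \<open>sub_add_cancel\<close> for \<open>\<sim> x\<close>, negated.\<close>

lemma add_sub_cancel:
  assumes "x \<in> C" "y \<in> C" "x \<preceq> \<sim> y"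
  shows "(x \<boxplus> y) \<boxminus> y = x"
proof -
  have "y \<preceq> \<sim> x"
    using assms by (metis neg_closed neg_le_neg_iff neg_neg)
  hence "(\<sim> x \<boxminus> y) \<boxplus> y = \<sim> x"
    using assms by (simp add: sub_add_cancel)
  thus ?thesis
    using assms by (simp add: sub_def)
qed

lemma sub_sub: "x \<in> C \<Longrightarrow> y \<in> C \<Longrightarrow> z \<in> C \<Longrightarrow> (x \<boxminus> y) \<boxminus> z = x \<boxminus> (y \<boxplus> z)"
  by (simp add: sub_def add_assoc)

lemma le_sub_swap:
  assumes "z \<in> C" "s \<in> C" "y \<in> C" "y \<preceq> s" "z \<preceq> s \<boxminus> y"
  shows "y \<preceq> s \<boxminus> z"
proof -
  have "\<sim> s \<boxplus> z \<preceq> \<sim> s \<boxplus> (s \<boxminus> y)"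
    using assms by (simp add: add_left_mono)
  also have "\<sim> s \<boxplus> (s \<boxminus> y) = (\<sim> y \<boxminus> \<sim> s) \<boxplus> \<sim> s"
    using assms by (simp add: sub_def add_comm)
  also have "\<dots> = \<sim> y"
    using assms by (simp add: sub_add_cancel neg_le_neg_iff)
  finally show ?thesis
    using assms by (metis add_closed neg_closed neg_le_neg_iff neg_neg sub_def)
qed

text \<open>The two differences have meet 0, phrased through lower bounds. If \<open>z\<close> lies
  below both and \<open>s\<close> is the join of \<open>x\<close> and \<open>y\<close>, then
  \<open>s \<boxminus> z\<close> still bounds \<open>x\<close> and \<open>y\<close>, so
  \<open>s \<preceq> s \<boxminus> z\<close>; as \<open>z \<preceq> s\<close>, this forces
  \<open>z\<close> to vanish.\<close>

lemma prelinearity: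
  assumes "x \<in> C" "y \<in> C" "z \<in> C" "z \<preceq> x \<boxminus> y" "z \<preceq> y \<boxminus> x"
  shows "z = \<^bold>0"
proof -
  define s where "s = (x \<boxminus> y) \<boxplus> y"
  have s': "s = (y \<boxminus> x) \<boxplus> x"
    using assms sub_add_comm s_def by simp
  have [simp]: "s \<in> C" "x \<preceq> s" "y \<preceq> s"
    using assms by (auto simp: s_def le_add2) (metis le_add2 s' s_def sub_closed)
  have "s \<boxminus> y = x \<boxminus> y" "s \<boxminus> x = y \<boxminus> x"
    using assms by (auto simp: s_def add_sub_cancel sub_le_neg) (metis add_sub_cancel s' s_def sub_closed sub_le_neg)
  hence "x \<preceq> s \<boxminus> z" "y \<preceq> s \<boxminus> z"
    using assms le_sub_swap [of z s x] le_sub_swap [of z s y] by simp_all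
  hence "s \<preceq> s \<boxminus> z"
    using assms sub_add_le [of x y "s \<boxminus> z"] s_def by simp
  hence "\<sim> s \<boxplus> z \<preceq> \<sim> s"
    using assms by (metis \<open>s \<in> C\<close> add_closed neg_closed neg_le_neg_iff neg_neg sub_def)
  hence "(z \<boxplus> \<sim> s) \<boxminus> \<sim> s = \<^bold>0"
    using assms by (simp add: sub_eq_bot_iff add_comm)
  moreover have "z \<preceq> s"
    using assms le_trans [of z "x \<boxminus> y" x] le_trans [of z x s] sub_le [of x y] by simp
  ultimately show ?thesis
    using assms by (simp add: add_sub_cancel)
qed

text \<open>By residuation \<open>z \<boxminus> k\<close> lies below both \<open>u\<close> and
  \<open>v\<close>.\<close>

lemma le_of_le_add_disjoint:
  assumes "z \<in> C" "k \<in> C" "u \<in> C" "v \<in> C" "z \<preceq> k \<boxplus> u" "z \<preceq> k \<boxplus> v"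
    and "\<And>w. w \<in> C \<Longrightarrow> w \<preceq> u \<Longrightarrow> w \<preceq> v \<Longrightarrow> w = \<^bold>0"
  shows "z \<preceq> k"
  using assms by (metis sub_closed sub_eq_bot_iff sub_le_iff)

abbreviation mult :: "nat \<Rightarrow> 'a \<Rightarrow> 'a" where "mult n u \<equiv> (add u ^^ n) \<^bold>0"

lemma mult_closed [simp, intro]: "u \<in> C \<Longrightarrow> mult n u \<in> C"
  by (induction n) auto

lemma mult_add: "u \<in> C \<Longrightarrow> mult (m + n) u = mult m u \<boxplus> mult n u"
  by (induction m) (simp_all add: add_assoc)

text \<open>An element below \<open>mult n u \<boxplus> u\<close> and below \<open>v\<close> is also
  below \<open>mult n u \<boxplus> v\<close>, so \<open>le_of_le_add_disjoint\<close> strips off the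
  last summand \<open>u\<close>.\<close>

lemma mult_disjoint:
  assumes "u \<in> C" "v \<in> C" and disj: "\<And>w. w \<in> C \<Longrightarrow> w \<preceq> u \<Longrightarrow> w \<preceq> v \<Longrightarrow> w = \<^bold>0"
  shows "w \<in> C \<Longrightarrow> w \<preceq> mult n u \<Longrightarrow> w \<preceq> v \<Longrightarrow> w = \<^bold>0"
proof (induction n)
  case 0
  thus ?case by (simp add: le_bot_iff)
next
  case (Suc n)
  have "w \<preceq> mult n u \<boxplus> u"
    using Suc.prems assms by (simp add: add_comm)
  moreover have "w \<preceq> mult n u \<boxplus> v"
    using Suc.prems assms by (meson add_closed le_add2 le_trans mult_closed)
  ultimately have "w \<preceq> mult n u"
    using Suc.prems(1) assms by (intro le_of_le_add_disjoint [of w "mult n u" u v]) auto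
  thus ?case using Suc by blast
qed

section \<open>Ideals, prime ideals and separation by a linearly ordered quotient\<close>

definition mv_ideal :: "'a set \<Rightarrow> bool" where
  "mv_ideal I \<longleftrightarrow> I \<subseteq> C \<and> \<^bold>0 \<in> I \<and> (\<forall>x\<in>I. \<forall>y\<in>I. x \<boxplus> y \<in> I) \<and>
     (\<forall>x\<in>I. \<forall>y\<in>C. y \<preceq> x \<longrightarrow> y \<in> I)"

text \<open>This is the ideal generated by \<open>I\<close> and \<open>u\<close>; it serves to
  contradict maximality in the Zorn argument.\<close>

lemma mv_ideal_insert:
  assumes I: "mv_ideal I" and u: "u \<in> C"
  shows "mv_ideal {z \<in> C. \<exists>k\<in>I. \<exists>n. z \<preceq> k \<boxplus> mult n u}" (is "mv_ideal ?J")
  unfolding mv_ideal_def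
proof (intro conjI ballI impI)
  have IC: "\<And>x. x \<in> I \<Longrightarrow> x \<in> C" using I by (auto simp: mv_ideal_def)
  show "?J \<subseteq> C" by blast
  show "\<^bold>0 \<in> ?J" using I u unfolding mv_ideal_def by (auto intro!: bexI [of _ "\<^bold>0"])
  show "x \<boxplus> y \<in> ?J" if xy: "x \<in> ?J" "y \<in> ?J" for x y
  proof -
    from xy obtain k n l m where *: "x \<in> C" "y \<in> C" "k \<in> I" "x \<preceq> k \<boxplus> mult n u"
      "l \<in> I" "y \<preceq> l \<boxplus> mult m u" by blast
    have kl: "k \<in> C" "l \<in> C" using * IC by blast+
    have "x \<boxplus> y \<preceq> (k \<boxplus> mult n u) \<boxplus> y"
      using * kl u by (simp add: add_right_mono)
    moreover have "(k \<boxplus> mult n u) \<boxplus> y \<preceq> (k \<boxplus> mult n u) \<boxplus> (l \<boxplus> mult m u)"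
      using * kl u by (simp add: add_left_mono)
    ultimately have "x \<boxplus> y \<preceq> (k \<boxplus> mult n u) \<boxplus> (l \<boxplus> mult m u)"
      using * kl u le_trans [of "x \<boxplus> y" "(k \<boxplus> mult n u) \<boxplus> y" "(k \<boxplus> mult n u) \<boxplus> (l \<boxplus> mult m u)"] by simp
    also have "\<dots> = (k \<boxplus> l) \<boxplus> mult (n + m) u"
      using kl u by (simp add: mult_add add_assoc add_lcomm)
    finally have "x \<boxplus> y \<preceq> (k \<boxplus> l) \<boxplus> mult (n + m) u" .
    moreover have "k \<boxplus> l \<in> I" using * I by (simp add: mv_ideal_def)
    ultimately show ?thesis using * by blast
  qed
  show "y \<in> ?J" if "x \<in> ?J" "y \<in> C" "y \<preceq> x" for x y
  proof -
    from that obtain k n where *: "x \<in> C" "k \<in> I" "x \<preceq> k \<boxplus> mult n u" by blast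
    hence "y \<preceq> k \<boxplus> mult n u"
      using le_trans [of y x "k \<boxplus> mult n u"] IC u that by simp
    thus ?thesis using * that by blast
  qed
qed

text \<open>An ideal maximal among those omitting \<open>c\<close> is prime. If both differences
  \<open>u\<close>, \<open>v\<close> were outside it, then \<open>c\<close> would lie below
  \<open>k \<boxplus> mult n u\<close> and \<open>l \<boxplus> mult m v\<close> with
  \<open>k\<close>, \<open>l\<close> in the ideal; multiples of \<open>u\<close> and
  \<open>v\<close> stay disjoint, so \<open>c \<preceq> k \<boxplus> l\<close>, a
  contradiction.\<close>

lemma prime_ideal_exists:
  assumes c: "c \<in> C" "c \<noteq> \<^bold>0"
  obtains I where "mv_ideal I" "c \<notin> I" "\<And>x y. x \<in> C \<Longrightarrow> y \<in> C \<Longrightarrow> x \<boxminus> y \<in> I \<or> y \<boxminus> x \<in> I"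
proof -
  let ?F = "{I. mv_ideal I \<and> c \<notin> I}"
  have "{\<^bold>0} \<in> ?F"
    using c by (auto simp: mv_ideal_def le_bot_iff)
  moreover have "\<Union>\<C> \<in> ?F" if "\<C> \<noteq> {}" "subset.chain ?F \<C>" for \<C>
  proof -
    have *: "mv_ideal I \<and> c \<notin> I" if "I \<in> \<C>" for I
      using \<open>subset.chain ?F \<C>\<close> that by (auto simp: subset_chain_def)
    have "x \<boxplus> y \<in> \<Union>\<C>" if xy: "x \<in> \<Union>\<C>" "y \<in> \<Union>\<C>" for x y
    proof -
      from xy obtain I J where IJ: "I \<in> \<C>" "J \<in> \<C>" "x \<in> I" "y \<in> J" by blast
      hence "I \<subseteq> J \<or> J \<subseteq> I"
        using \<open>subset.chain ?F \<C>\<close> by (auto simp: subset_chain_def)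
      thus ?thesis using IJ * unfolding mv_ideal_def by blast
    qed
    moreover have "\<^bold>0 \<in> \<Union>\<C>" "\<Union>\<C> \<subseteq> C" "c \<notin> \<Union>\<C>"
      using * \<open>\<C> \<noteq> {}\<close> unfolding mv_ideal_def by blast+
    moreover have "\<forall>x\<in>\<Union>\<C>. \<forall>y\<in>C. y \<preceq> x \<longrightarrow> y \<in> \<Union>\<C>"
      using * unfolding mv_ideal_def by blast
    ultimately show ?thesis by (simp add: mv_ideal_def)
  qed
  ultimately obtain I where I: "I \<in> ?F" and max: "\<And>J. J \<in> ?F \<Longrightarrow> I \<subseteq> J \<Longrightarrow> J = I"
    using subset_Zorn_nonempty [of ?F] by auto
  have IC: "\<And>x. x \<in> I \<Longrightarrow> x \<in> C" using I by (auto simp: mv_ideal_def)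
  have gen: "\<exists>k\<in>I. \<exists>n. c \<preceq> k \<boxplus> mult n u" if u: "u \<in> C" "u \<notin> I" for u
  proof (rule ccontr)
    let ?J = "{z \<in> C. \<exists>k\<in>I. \<exists>n. z \<preceq> k \<boxplus> mult n u}"
    assume "\<not> ?thesis"
    hence "?J \<in> ?F" using mv_ideal_insert [of I u] I u by blast
    moreover have "I \<subseteq> ?J"
    proof
      fix x assume "x \<in> I"
      thus "x \<in> ?J" using u IC le_add1 mult_closed by blast
    qed
    moreover have "u \<in> ?J"
    proof -
      have "u \<preceq> \<^bold>0 \<boxplus> mult 1 u" using u by simp
      moreover have "\<^bold>0 \<in> I" using I by (simp add: mv_ideal_def)
      ultimately show ?thesis using u by blast
    qed
    ultimately show False using max u by blast
  qed
  have "x \<boxminus> y \<in> I \<or> y \<boxminus> x \<in> I" if xy: "x \<in> C" "y \<in> C" for x y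
  proof (rule ccontr)
    define u where "u = x \<boxminus> y"
    define v where "v = y \<boxminus> x"
    assume "\<not> ?thesis"
    hence uv: "u \<in> C" "u \<notin> I" "v \<in> C" "v \<notin> I" using xy by (auto simp: u_def v_def)
    obtain k n where k: "k \<in> I" "c \<preceq> k \<boxplus> mult n u"
      using gen [OF uv(1,2)] by blast
    obtain l m where l: "l \<in> I" "c \<preceq> l \<boxplus> mult m v"
      using gen [OF uv(3,4)] by blast
    note * = k l
    have kl: "k \<in> C" "l \<in> C" using * IC by blast+
    have klI: "k \<boxplus> l \<in> I" using * I by (simp add: mv_ideal_def)
    have "w = \<^bold>0" if "w \<in> C" "w \<preceq> u" "w \<preceq> v" for w
      using prelinearity [of x y w] xy that by (simp add: u_def v_def)
    hence "w = \<^bold>0" if "w \<in> C" "w \<preceq> mult n u" "w \<preceq> v" for w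
      using mult_disjoint [OF uv(1,3)] that by blast
    hence disj: "w = \<^bold>0" if "w \<in> C" "w \<preceq> mult n u" "w \<preceq> mult m v" for w
      using mult_disjoint [of v "mult n u"] that uv by blast
    have "k \<boxplus> mult n u \<preceq> (k \<boxplus> l) \<boxplus> mult n u" "l \<boxplus> mult m v \<preceq> (k \<boxplus> l) \<boxplus> mult m v"
      using kl uv by (simp_all add: add_right_mono le_add1 le_add2)
    hence "c \<preceq> (k \<boxplus> l) \<boxplus> mult n u" "c \<preceq> (k \<boxplus> l) \<boxplus> mult m v"
      using * kl uv c le_trans [of c "k \<boxplus> mult n u" "(k \<boxplus> l) \<boxplus> mult n u"]
        le_trans [of c "l \<boxplus> mult m v" "(k \<boxplus> l) \<boxplus> mult m v"] by simp_all
    hence "c \<preceq> k \<boxplus> l"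
      using le_of_le_add_disjoint [of c "k \<boxplus> l" "mult n u" "mult m v"] disj kl uv c by simp
    thus False using klI I c unfolding mv_ideal_def by blast
  qed
  thus ?thesis using that I by blast
qed

end

text \<open>Nontriviality lets 0 serve as a fractional part in Chang's group, where the top element
  is excluded.\<close>

locale mv_chain = mv_algebra +
  assumes total: "x \<in> C \<Longrightarrow> y \<in> C \<Longrightarrow> x \<preceq> y \<or> y \<preceq> x"
    and bot_ne_top: "\<^bold>0 \<noteq> \<^bold>1"

context mv_algebra
begin

text \<open>The quotient by a prime ideal is realised on representatives: \<open>q\<close> selects
  one from each class, so the carrier stays inside the original type and each operation is followed
  by \<open>q\<close>.\<close>

lemma chain_quotient:
  assumes ab: "a \<in> C" "b \<in> C" "a \<noteq> b"
  obtains q where "mv_chain (q ` C) (\<lambda>x y. q (x \<boxplus> y)) (\<lambda>x. q (\<sim> x)) (q \<^bold>0)"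
    and "\<And>x y. x \<in> C \<Longrightarrow> y \<in> C \<Longrightarrow> q (q x \<boxplus> q y) = q (x \<boxplus> y)"
    and "\<And>x. x \<in> C \<Longrightarrow> q (\<sim> q x) = q (\<sim> x)"
    and "q a \<noteq> q b"
proof -
  \<comment> \<open>By antisymmetry one of the two differences is nonzero; an ideal that omits it
    keeps \<open>a\<close> and \<open>b\<close> apart.\<close>
  obtain c where c: "c \<in> C" "c \<noteq> \<^bold>0" "c = a \<boxminus> b \<or> c = b \<boxminus> a"
    using ab le_antisym [of a b] sub_eq_bot_iff [of a b] sub_eq_bot_iff [of b a] sub_closed by blast
  obtain I where I: "mv_ideal I" "c \<notin> I"
    and prime: "\<And>x y. x \<in> C \<Longrightarrow> y \<in> C \<Longrightarrow> x \<boxminus> y \<in> I \<or> y \<boxminus> x \<in> I"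
    using prime_ideal_exists [OF c(1,2)] by blast
  have Iadd: "x \<boxplus> y \<in> I" if "x \<in> I" "y \<in> I" for x y using I that by (auto simp: mv_ideal_def)
  have Ile: "x \<in> I" if "x \<in> C" "y \<in> I" "x \<preceq> y" for x y using I that by (auto simp: mv_ideal_def)
  have Ibot: "\<^bold>0 \<in> I" and IC: "I \<subseteq> C" using I by (auto simp: mv_ideal_def)
  define E where "E x y \<longleftrightarrow> x \<in> C \<and> y \<in> C \<and> x \<boxminus> y \<in> I \<and> y \<boxminus> x \<in> I" for x y
  have E_refl: "E x x" if "x \<in> C" for x
    using that Ibot by (simp add: E_def sub_def)
  have E_sym: "E y x" if "E x y" for x y
    using that by (simp add: E_def)
  have sub_tri: "x \<boxminus> z \<in> I" if "x \<in> C" "y \<in> C" "z \<in> C" "x \<boxminus> y \<in> I" "y \<boxminus> z \<in> I" for x y z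
  proof -
    have "x \<preceq> y \<boxplus> (x \<boxminus> y)"
      using that by (simp add: le_add_sub)
    moreover have "y \<boxplus> (x \<boxminus> y) \<preceq> (z \<boxplus> (y \<boxminus> z)) \<boxplus> (x \<boxminus> y)"
      using that by (simp add: le_add_sub add_right_mono)
    ultimately have "x \<preceq> (z \<boxplus> (y \<boxminus> z)) \<boxplus> (x \<boxminus> y)"
      using that le_trans [of x "y \<boxplus> (x \<boxminus> y)" "(z \<boxplus> (y \<boxminus> z)) \<boxplus> (x \<boxminus> y)"] by simp
    hence "x \<boxminus> z \<preceq> (y \<boxminus> z) \<boxplus> (x \<boxminus> y)"
      using that by (simp add: sub_le_iff add_assoc)
    thus ?thesis using that Iadd Ile by (meson sub_closed)
  qed
  have E_trans: "E x z" if "E x y" "E y z" for x y z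
    using that sub_tri unfolding E_def by blast
  have E_neg: "E (\<sim> x) (\<sim> y)" if "E x y" for x y
    using that unfolding E_def by (auto simp: sub_def add_comm)
  have sub_add: "(x \<boxplus> z) \<boxminus> (y \<boxplus> z) \<in> I" if "x \<in> C" "y \<in> C" "z \<in> C" "x \<boxminus> y \<in> I" for x y z
  proof -
    have "x \<boxplus> z \<preceq> (y \<boxplus> (x \<boxminus> y)) \<boxplus> z"
      using that by (simp add: le_add_sub add_right_mono)
    also have "\<dots> = (y \<boxplus> z) \<boxplus> (x \<boxminus> y)"
      using that by (simp add: add_assoc add_comm add_lcomm)
    finally have "(x \<boxplus> z) \<boxminus> (y \<boxplus> z) \<preceq> x \<boxminus> y" using that by (simp add: sub_le_iff)
    thus ?thesis using that Ile [of "(x \<boxplus> z) \<boxminus> (y \<boxplus> z)" "x \<boxminus> y"] by simp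
  qed
  have E_add1: "E (x \<boxplus> z) (y \<boxplus> z)" if "E x y" "z \<in> C" for x y z
    using that sub_add [of x y z] sub_add [of y x z] by (simp add: E_def)
  have E_add: "E (x \<boxplus> x') (y \<boxplus> y')" if "E x y" "E x' y'" for x y x' y'
  proof -
    have "x \<in> C" "y \<in> C" "x' \<in> C" "y' \<in> C" using that by (auto simp: E_def)
    thus ?thesis
      using E_trans [OF E_add1 [OF that(1), of x'] , of "y \<boxplus> y'"] E_add1 [OF that(2), of y]
      by (simp add: add_comm)
  qed
  define q where "q x = (SOME y. E x y)" for x
  have Eq: "E x (q x)" if "x \<in> C" for x
    unfolding q_def using E_refl that by (metis someI)
  have q_cong: "q x = q y" if "E x y" for x y
  proof -
    \<comment> \<open>Equivalent elements define the same predicate, hence the same choice.\<close>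
    have "E x = E y" using that E_sym E_trans by blast
    thus ?thesis by (simp add: q_def)
  qed
  have q_iff: "q x = q y \<longleftrightarrow> E x y" if "x \<in> C" "y \<in> C" for x y
    using that by (metis Eq E_sym E_trans q_cong)
  have qC [simp]: "q x \<in> C" if "x \<in> C" for x
    using Eq that E_def by blast
  have qq [simp]: "q (q x) = q x" if "x \<in> C" for x
    using Eq q_cong that by metis
  have q_add [simp]: "q (q x \<boxplus> y) = q (x \<boxplus> y)" "q (y \<boxplus> q x) = q (y \<boxplus> x)" if "x \<in> C" "y \<in> C" for x y
    using that q_cong [OF E_add [OF E_sym [OF Eq] E_refl]] q_cong [OF E_add [OF E_refl E_sym [OF Eq]]] by simp_all
  have q_neg [simp]: "q (\<sim> q x) = q (\<sim> x)" if "x \<in> C" for x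
    using that by (metis E_neg E_sym Eq q_cong)
  have "q a \<noteq> q b"
    using c I ab by (auto simp: q_iff E_def)
  interpret Q: mv_algebra "q ` C" "\<lambda>x y. q (x \<boxplus> y)" "\<lambda>x. q (\<sim> x)" "q \<^bold>0"
  proof unfold_locales
    fix x y assume "x \<in> q ` C" "y \<in> q ` C"
    then obtain x' y' where "x' \<in> C" "y' \<in> C" "x = q x'" "y = q y'" by blast
    thus "q (q (\<sim> q (q (\<sim> x) \<boxplus> y)) \<boxplus> y) = q (q (\<sim> q (q (\<sim> y) \<boxplus> x)) \<boxplus> x)"
      by (simp add: lukasiewicz)
  qed (auto simp: add_assoc, auto simp: add_comm)
  have "mv_chain (q ` C) (\<lambda>x y. q (x \<boxplus> y)) (\<lambda>x. q (\<sim> x)) (q \<^bold>0)"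
  proof unfold_locales
    have "Q.le (q x) (q y)" if "x \<in> C" "y \<in> C" "x \<boxminus> y \<in> I" for x y
    proof -
      have "E (\<sim> (\<sim> x \<boxplus> y)) \<^bold>0"
        using that Ibot by (simp add: E_def sub_def add_comm)
      hence "E (\<sim> x \<boxplus> y) \<^bold>1"
        using that E_neg by (metis add_closed neg_closed neg_neg)
      thus ?thesis using that q_cong by (simp add: Q.le_def)
    qed
    thus "Q.le x y \<or> Q.le y x" if "x \<in> q ` C" "y \<in> q ` C" for x y
      using that prime by blast
    show "q \<^bold>0 \<noteq> q (\<sim> q \<^bold>0)"
    proof
      assume "q \<^bold>0 = q (\<sim> q \<^bold>0)"
      \<comment> \<open>If 0 and 1 are identified, then so are x = x + 0 and x + 1 = 1, for every
        x.\<close>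
      hence "q x = q \<^bold>1" if "x \<in> C" for x
        using that by (metis add_bot add_top bot_closed neg_closed q_add(2) q_neg)
      thus False using ab \<open>q a \<noteq> q b\<close> by metis
    qed
  qed
  thus ?thesis using that \<open>q a \<noteq> q b\<close> by simp
qed

end

section \<open>Real solutions of finitely many linear conditions\<close>

lemma exists_real_between_finite:
  fixes A B :: "real set"
  assumes "finite A" "finite B" and lt: "\<And>a b. a \<in> A \<Longrightarrow> b \<in> B \<Longrightarrow> a < b"
  obtains v where "\<And>a. a \<in> A \<Longrightarrow> a < v" "\<And>b. b \<in> B \<Longrightarrow> v < b"
proof (cases "A = {} \<or> B = {}")
  case True
  obtain l where "\<And>b. b \<in> B \<Longrightarrow> l < b"
    using assms(2) by (metis bdd_below_finite bdd_below_def lt_ex order_less_le_trans)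
  moreover obtain u where "\<And>a. a \<in> A \<Longrightarrow> a < u"
    using assms(1) by (metis bdd_above_finite bdd_above_def gt_ex order_le_less_trans)
  ultimately show ?thesis using True that by blast
next
  case False
  hence "Max A < Min B" using assms by simp
  then obtain v where "Max A < v" "v < Min B" using dense by blast
  thus ?thesis using that False assms by (meson Max_less_iff Min_gr_iff)
qed

abbreviation lin_form :: "'a set \<Rightarrow> ('a \<Rightarrow> real) \<Rightarrow> ('a \<Rightarrow>\<^sub>0 int) \<Rightarrow> real" where
  "lin_form S x f \<equiv> \<Sum>c\<in>S. real_of_int (Poly_Mapping.lookup f c) * x c"

text \<open>Reading \<open>g - f \<in> K\<close> as \<open>f \<le> g\<close> gives a
  translation-invariant total preorder on the free abelian group. Both \<open>f\<close> and
  \<open>- f\<close> may lie in \<open>K\<close>; this encodes an equation.\<close>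

locale total_cone =
  fixes K :: "('a \<Rightarrow>\<^sub>0 int) set"
  assumes cone_add: "f \<in> K \<Longrightarrow> g \<in> K \<Longrightarrow> f + g \<in> K"
    and cone_total: "f \<in> K \<or> - f \<in> K"
begin

lemma cone_zero: "0 \<in> K"
  using cone_total [of 0] by simp

lemma cone_cmul_nat: "f \<in> K \<Longrightarrow> frag_cmul (int n) f \<in> K"
  by (induction n) (simp_all add: cone_zero cone_add frag_cmul_distrib)

text \<open>For the converse, with \<open>k = n + 1\<close>: otherwise totality puts
  \<open>- f\<close> in \<open>K\<close>, and adding \<open>n\<close> copies of it to
  \<open>k\<close> times \<open>f\<close> returns \<open>f\<close>.\<close>

lemma cone_cmul_iff:
  assumes "k > 0"
  shows "frag_cmul k f \<in> K \<longleftrightarrow> f \<in> K"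
proof
  obtain n where n: "k = int (Suc n)"
    using assms by (metis gr0_implies_Suc zero_less_imp_eq_int)
  show "frag_cmul k f \<in> K" if "f \<in> K" using cone_cmul_nat [OF that, of "Suc n"] n by simp
  assume *: "frag_cmul k f \<in> K"
  show "f \<in> K"
  proof (rule ccontr)
    assume "f \<notin> K"
    hence "frag_cmul (int n) (- f) \<in> K" using cone_total cone_cmul_nat by blast
    hence "frag_cmul k f + frag_cmul (int n) (- f) \<in> K" using * cone_add by blast
    moreover have "frag_cmul k f + frag_cmul (int n) (- f) = f"
      by (rule poly_mapping_eqI) (simp add: n lookup_add algebra_simps)
    ultimately show False using \<open>f \<notin> K\<close> by simp
  qed
qed

text \<open>One coordinate \<open>y\<close> is eliminated at a time: forms involving
  \<open>y\<close> are replaced by combinations of pairs in which \<open>y\<close> cancels, and a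
  value for \<open>y\<close> is chosen afterwards. The equivalence also reproduces non-membership,
  so strict inequalities and equations are preserved.\<close>

theorem fourier_motzkin:
  assumes "finite S" "finite L" "\<And>f. f \<in> L \<Longrightarrow> Poly_Mapping.keys f \<subseteq> S"
  shows "\<exists>x. \<forall>f\<in>L. f \<in> K \<longleftrightarrow> 0 \<le> lin_form S x f"
  using assms
proof (induction S arbitrary: L rule: finite_induct)
  case empty
  hence "f = 0" if "f \<in> L" for f using that by auto
  thus ?case using cone_zero by auto
next
  case (insert y S)
  let ?a = "\<lambda>f. Poly_Mapping.lookup f y"
  \<comment> \<open>Up to sign every form involving \<open>y\<close> has a positive coefficient
    there; then \<open>f \<in> K\<close> acts as a lower bound for the new coordinate and
    \<open>- f \<in> K\<close> as an upper bound.\<close>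
  define P where "P = {f \<in> L \<union> uminus ` L. 0 < ?a f}"
  define comb where "comb f g = frag_cmul (?a g) f - frag_cmul (?a f) g" for f g
  define L' where "L' = {f \<in> L. ?a f = 0} \<union> (\<lambda>(f, g). comb f g) ` (P \<times> P)"
  have P: "finite P" "\<And>f. f \<in> P \<Longrightarrow> 0 < ?a f"
    using insert.prems by (auto simp: P_def)
  have keysP: "Poly_Mapping.keys f \<subseteq> insert y S" if "f \<in> P" for f
    using insert.prems(2) that by (fastforce simp: P_def)
  have "finite L'"
    using insert.prems P by (simp add: L'_def)
  moreover have "Poly_Mapping.keys f \<subseteq> S" if "f \<in> L'" for f
  proof -
    have "Poly_Mapping.keys f \<subseteq> insert y S"
      using that insert.prems(2) keysP unfolding L'_def comb_def
      by (auto dest!: subsetD [OF keys_diff])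
    moreover have "y \<notin> Poly_Mapping.keys f"
      using that by (auto simp: L'_def comb_def in_keys_iff lookup_minus)
    ultimately show ?thesis by blast
  qed
  ultimately obtain x where x: "\<And>f. f \<in> L' \<Longrightarrow> f \<in> K \<longleftrightarrow> 0 \<le> lin_form S x f"
    using insert.IH by metis
  \<comment> \<open>The value of the new coordinate at which \<open>f\<close> vanishes.\<close>
  define \<tau> where "\<tau> f = - lin_form S x f / ?a f" for f
  have comb_iff: "comb f g \<in> K \<longleftrightarrow> \<tau> f \<le> \<tau> g" if "f \<in> P" "g \<in> P" for f g
  proof -
    have "lin_form S x (comb f g) = ?a g * lin_form S x f - ?a f * lin_form S x g"
      by (simp add: comb_def lookup_minus left_diff_distrib sum_subtractf sum_distrib_left mult.assoc)
    moreover have "comb f g \<in> K \<longleftrightarrow> 0 \<le> lin_form S x (comb f g)"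
      using that by (intro x) (auto simp: L'_def)
    ultimately show ?thesis
      using P(2) [OF that(1)] P(2) [OF that(2)] by (simp add: \<tau>_def divide_simps mult.commute)
  qed
  \<comment> \<open>A lower bound never exceeds an upper bound, since \<open>comb f g\<close> is a
    positive combination of \<open>f\<close> and \<open>- g\<close>. A tie is possible only if both
    forms are equations in \<open>K\<close>.\<close>
  have up_down: "\<tau> f \<le> \<tau> g \<and> (\<tau> f = \<tau> g \<longrightarrow> - f \<in> K \<and> g \<in> K)"
    if fg: "f \<in> P" "g \<in> P" "f \<in> K" "- g \<in> K" for f g
  proof -
    have pos: "0 < ?a f" "0 < ?a g" using fg P by auto
    have f: "frag_cmul (?a g) f \<in> K" and g: "frag_cmul (?a f) (- g) \<in> K"
      using fg pos by (simp_all add: cone_cmul_iff)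
    have "comb f g = frag_cmul (?a g) f + frag_cmul (?a f) (- g)"
      by (rule poly_mapping_eqI) (simp add: comb_def lookup_add lookup_minus)
    hence "\<tau> f \<le> \<tau> g" using cone_add [OF f g] comb_iff [OF fg(1,2)] by simp
    moreover have "- f \<in> K \<and> g \<in> K" if "\<tau> f = \<tau> g"
    proof -
      have c: "comb g f \<in> K" using that comb_iff [OF fg(2,1)] by simp
      have "comb g f + frag_cmul (?a f) (- g) = frag_cmul (?a g) (- f)"
        "comb g f + frag_cmul (?a g) f = frag_cmul (?a f) g"
        by (rule poly_mapping_eqI, simp add: comb_def lookup_add lookup_minus)+
      thus ?thesis using c f g cone_add cone_cmul_iff pos by metis
    qed
    ultimately show ?thesis by blast
  qed
  obtain v where v: "\<And>f. f \<in> P \<Longrightarrow> (f \<in> K \<longleftrightarrow> \<tau> f \<le> v) \<and> (- f \<in> K \<longleftrightarrow> v \<le> \<tau> f)"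
  \<comment> \<open>An equation in \<open>K\<close> forces the coordinate. Without one, all bounds
    have to be met strictly, which two finite sets permit.\<close>
  proof (cases "\<exists>f\<in>P. f \<in> K \<and> - f \<in> K")
    case True
    then obtain f where f: "f \<in> P" "f \<in> K" "- f \<in> K" by blast
    show ?thesis
    proof (rule that)
      fix g assume g: "g \<in> P"
      show "(g \<in> K \<longleftrightarrow> \<tau> g \<le> \<tau> f) \<and> (- g \<in> K \<longleftrightarrow> \<tau> f \<le> \<tau> g)"
        using up_down [OF f(1) g f(2)] up_down [OF g f(1) _ f(3)] cone_total [of g] by force
    qed
  next
    case False
    have lt: "\<tau> f < \<tau> g" if "f \<in> P" "g \<in> P" "f \<in> K" "- g \<in> K" for f g
      using up_down [OF that] that False by force
    obtain v where v: "\<And>a. a \<in> \<tau> ` {f \<in> P. f \<in> K} \<Longrightarrow> a < v" "\<And>b. b \<in> \<tau> ` {f \<in> P. - f \<in> K} \<Longrightarrow> v < b"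
      by (rule exists_real_between_finite [of "\<tau> ` {f \<in> P. f \<in> K}" "\<tau> ` {f \<in> P. - f \<in> K}"])
        (use P(1) lt in auto)
    show ?thesis
    proof (rule that)
      fix f assume "f \<in> P"
      thus "(f \<in> K \<longleftrightarrow> \<tau> f \<le> v) \<and> (- f \<in> K \<longleftrightarrow> v \<le> \<tau> f)"
        using v(1) [of "\<tau> f"] v(2) [of "\<tau> f"] cone_total [of f] by force
    qed
  qed
  define x' where "x' = x(y := v)"
  have lin: "lin_form (insert y S) x' f = ?a f * v + lin_form S x f" for f
    using insert.hyps by (auto simp: x'_def intro!: sum.cong)
  have pos: "(f \<in> K \<longleftrightarrow> 0 \<le> lin_form (insert y S) x' f) \<and> (- f \<in> K \<longleftrightarrow> lin_form (insert y S) x' f \<le> 0)"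
    if "f \<in> P" for f
  proof -
    have "- M / a \<le> v \<longleftrightarrow> 0 \<le> a * v + M" "v \<le> - M / a \<longleftrightarrow> a * v + M \<le> 0" if "0 < a" for M a :: real
      using that by (auto simp: field_simps)
    thus ?thesis
      using v [OF that] P(2) [OF that] unfolding lin \<tau>_def by simp
  qed
  have "f \<in> K \<longleftrightarrow> 0 \<le> lin_form (insert y S) x' f" if f: "f \<in> L" for f
  proof (cases "?a f" "0 :: int" rule: linorder_cases)
    case less
    hence "- f \<in> P" using f by (auto simp: P_def)
    from pos [OF this] show ?thesis by (simp add: sum_negf)
  next
    case equal
    hence "f \<in> L'" using f by (auto simp: L'_def)
    thus ?thesis using x equal lin by simp
  next
    case greater
    hence "f \<in> P" using f by (auto simp: P_def)
    thus ?thesis using pos by blast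
  qed
  thus ?case by blast
qed

end

section \<open>Chang's group of a linearly ordered MV-algebra\<close>

context mv_chain
begin

text \<open>Lukasiewicz conjunction, in the unit interval \<open>max 0 (x + y - 1)\<close>: the
  fractional part left over when a sum carries.\<close>

definition mul :: "'a \<Rightarrow> 'a \<Rightarrow> 'a" (infixl \<open>\<boxtimes>\<close> 70) where "x \<boxtimes> y = \<sim> (\<sim> x \<boxplus> \<sim> y)"

lemma mul_closed [simp, intro]: "x \<in> C \<Longrightarrow> y \<in> C \<Longrightarrow> x \<boxtimes> y \<in> C"
  by (simp add: mul_def)

lemma mul_comm: "x \<in> C \<Longrightarrow> y \<in> C \<Longrightarrow> x \<boxtimes> y = y \<boxtimes> x"
  by (simp add: mul_def add_comm)

lemma mul_assoc: "x \<in> C \<Longrightarrow> y \<in> C \<Longrightarrow> z \<in> C \<Longrightarrow> (x \<boxtimes> y) \<boxtimes> z = x \<boxtimes> (y \<boxtimes> z)"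
  by (simp add: mul_def add_assoc)

lemma mul_eq_sub: "x \<in> C \<Longrightarrow> y \<in> C \<Longrightarrow> x \<boxtimes> y = x \<boxminus> \<sim> y"
  by (simp add: mul_def sub_def)

lemma top_le_iff: "x \<in> C \<Longrightarrow> \<^bold>1 \<preceq> x \<longleftrightarrow> x = \<^bold>1"
  by (simp add: le_def)

lemma mul_ne_top:
  assumes "x \<in> C" "y \<in> C" "x \<noteq> \<^bold>1"
  shows "x \<boxtimes> y \<noteq> \<^bold>1"
  using assms sub_le [of x "\<sim> y"] by (auto simp: mul_eq_sub top_le_iff)

lemma add_eq_top_iff: "x \<in> C \<Longrightarrow> y \<in> C \<Longrightarrow> x \<boxplus> y = \<^bold>1 \<longleftrightarrow> \<sim> x \<preceq> y"
  by (simp add: le_def)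

text \<open>Here linearity enters: if neither element lies above the complement of the other, the
  order must go the other way. A sum different from top is thus never truncated.\<close>

lemma add_ne_topD:
  assumes "x \<in> C" "y \<in> C" "x \<boxplus> y \<noteq> \<^bold>1"
  shows "y \<preceq> \<sim> x" "x \<preceq> \<sim> y"
  using assms total [of "\<sim> x" y] total [of "\<sim> y" x] add_eq_top_iff [of x y] add_eq_top_iff [of y x]
  by (auto simp: add_comm)

text \<open>Neither \<open>a + b\<close> nor \<open>b + c\<close> overflows, so both sides are the
  truncation of \<open>a + b + c - 1\<close> at 0. The proof splits \<open>b\<close> off
  \<open>\<sim> c\<close> and cancels it.\<close>

lemma add_mul_swap:
  assumes C: "a \<in> C" "b \<in> C" "c \<in> C" and le: "b \<preceq> \<sim> a" "b \<preceq> \<sim> c"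
  shows "(a \<boxplus> b) \<boxtimes> c = a \<boxtimes> (b \<boxplus> c)"
proof -
  have "a \<preceq> \<sim> b" using C le by (metis neg_closed neg_le_neg_iff neg_neg)
  have "\<sim> c = b \<boxplus> (\<sim> c \<boxminus> b)"
    using C le sub_add_cancel [of b "\<sim> c"] add_comm by simp
  hence "(a \<boxplus> b) \<boxtimes> c = (a \<boxplus> b) \<boxminus> (b \<boxplus> (\<sim> c \<boxminus> b))"
    using C by (simp add: mul_eq_sub)
  also have "\<dots> = ((a \<boxplus> b) \<boxminus> b) \<boxminus> (\<sim> c \<boxminus> b)"
    using C by (simp add: sub_sub)
  also have "\<dots> = a \<boxminus> (\<sim> c \<boxminus> b)"
    using C \<open>a \<preceq> \<sim> b\<close> by (simp add: add_sub_cancel)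
  also have "\<dots> = a \<boxtimes> (b \<boxplus> c)"
    using C by (simp add: mul_eq_sub sub_def add_comm)
  finally show ?thesis .
qed

text \<open>Here \<open>a + b\<close> does not overflow while \<open>b + c\<close> reaches 1, so
  both sides are \<open>a + b + c - 1\<close>. Writing \<open>b\<close> as
  \<open>w \<boxplus> d\<close> with \<open>d\<close> the complement of \<open>c\<close> makes
  \<open>w\<close> the remainder \<open>b \<boxtimes> c\<close>.\<close>

lemma add_mul_assoc:
  assumes C: "a \<in> C" "b \<in> C" "c \<in> C" and le: "b \<preceq> \<sim> a" "\<sim> c \<preceq> b"
  shows "(a \<boxplus> b) \<boxtimes> c = a \<boxplus> (b \<boxtimes> c)"
proof -
  define d where "d = \<sim> c"
  define w where "w = b \<boxminus> d"
  have [simp]: "d \<in> C" "w \<in> C" using C by (auto simp: d_def w_def)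
  have b: "b = w \<boxplus> d" using C le by (simp add: w_def d_def sub_add_cancel)
  have wd: "w \<preceq> \<sim> d" using C by (simp add: w_def sub_le_neg)
  have "a \<preceq> \<sim> b" using C le by (metis neg_closed neg_le_neg_iff neg_neg)
  also have "\<sim> b = \<sim> d \<boxminus> w" by (simp add: b sub_def add_comm)
  finally have "a \<boxplus> w \<preceq> (\<sim> d \<boxminus> w) \<boxplus> w" using C by (simp add: add_right_mono)
  also have "\<dots> = \<sim> d" using wd by (simp add: sub_add_cancel)
  finally have le: "a \<boxplus> w \<preceq> \<sim> d" .
  have "(a \<boxplus> b) \<boxtimes> c = ((a \<boxplus> w) \<boxplus> d) \<boxminus> d"
    using C by (subst mul_eq_sub) (auto simp: b add_assoc d_def)
  also have "\<dots> = a \<boxplus> w" using C le by (simp add: add_sub_cancel)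
  finally show ?thesis using C by (simp add: w_def d_def mul_eq_sub)
qed

text \<open>The pair \<open>(m, a)\<close> with \<open>a \<noteq> \<^bold>1\<close> stands for \<open>m + a\<close>.\<close>

fun carry_add :: "int \<times> 'a \<Rightarrow> int \<times> 'a \<Rightarrow> int \<times> 'a" where
  "carry_add (m, a) (n, b) = (if a \<boxplus> b = \<^bold>1 then (m + n + 1, a \<boxtimes> b) else (m + n, a \<boxplus> b))"

definition chang_group :: "(int \<times> 'a) monoid" where
  "chang_group = \<lparr>carrier = UNIV \<times> (C - {\<^bold>1}), monoid.mult = carry_add, one = (0, \<^bold>0)\<rparr>"

text \<open>The cases record which of the inner sums carries. When exactly one does,
  \<open>mul_ne_top\<close> excludes a second carry, so both bracketings carry once.\<close>

lemma carry_add_assoc: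
  assumes "a \<in> C" "b \<in> C" "c \<in> C" "a \<noteq> \<^bold>1" "b \<noteq> \<^bold>1" "c \<noteq> \<^bold>1"
  shows "carry_add (carry_add (m, a) (n, b)) (k, c) = carry_add (m, a) (carry_add (n, b) (k, c))"
proof (cases "a \<boxplus> b = \<^bold>1"; cases "b \<boxplus> c = \<^bold>1")
  assume *: "a \<boxplus> b \<noteq> \<^bold>1" "b \<boxplus> c \<noteq> \<^bold>1"
  hence "(a \<boxplus> b) \<boxtimes> c = a \<boxtimes> (b \<boxplus> c)"
    using assms add_ne_topD [of a b] add_ne_topD [of b c] by (simp add: add_mul_swap)
  thus ?thesis using assms * by (simp add: add_assoc)
next
  assume *: "a \<boxplus> b \<noteq> \<^bold>1" "b \<boxplus> c = \<^bold>1"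
  hence eq: "(a \<boxplus> b) \<boxtimes> c = a \<boxplus> (b \<boxtimes> c)"
    using assms add_ne_topD [of a b] add_eq_top_iff [of c b] by (intro add_mul_assoc) (auto simp: add_comm)
  moreover have "a \<boxplus> (b \<boxtimes> c) \<noteq> \<^bold>1"
    using eq * assms mul_ne_top [of "a \<boxplus> b" c] by simp
  ultimately show ?thesis using assms * by (simp add: add_assoc)
next
  \<comment> \<open>Mirror image of the previous case, with \<open>a\<close> and \<open>c\<close>
    exchanged.\<close>
  assume *: "a \<boxplus> b = \<^bold>1" "b \<boxplus> c \<noteq> \<^bold>1"
  hence "(c \<boxplus> b) \<boxtimes> a = c \<boxplus> (b \<boxtimes> a)"
    using assms add_ne_topD [of b c] add_eq_top_iff [of a b] by (intro add_mul_assoc) (auto simp: add_comm)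
  hence eq: "a \<boxtimes> (b \<boxplus> c) = (a \<boxtimes> b) \<boxplus> c"
    using assms by (simp add: add_comm mul_comm)
  moreover have "(a \<boxtimes> b) \<boxplus> c \<noteq> \<^bold>1"
    using eq * assms mul_ne_top [of "b \<boxplus> c" a] by (simp add: mul_comm)
  moreover have "a \<boxplus> (b \<boxplus> c) = \<^bold>1"
    using * assms by (simp flip: add_assoc)
  ultimately show ?thesis using assms * by simp
next
  \<comment> \<open>Complements turn the double carry into the carry-free situation, where
    \<open>add_mul_swap\<close> applies.\<close>
  assume *: "a \<boxplus> b = \<^bold>1" "b \<boxplus> c = \<^bold>1"
  have "\<sim> b \<preceq> a" "\<sim> b \<preceq> c"
    using * assms add_eq_top_iff [of b a] add_eq_top_iff [of b c] by (auto simp: add_comm)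
  hence "(\<sim> a \<boxplus> \<sim> b) \<boxtimes> \<sim> c = \<sim> a \<boxtimes> (\<sim> b \<boxplus> \<sim> c)"
    using assms by (intro add_mul_swap) auto
  hence "\<sim> ((a \<boxtimes> b) \<boxplus> c) = \<sim> (a \<boxplus> (b \<boxtimes> c))"
    using assms by (simp add: mul_def)
  hence "(a \<boxtimes> b) \<boxplus> c = a \<boxplus> (b \<boxtimes> c)"
    using assms by (metis add_closed mul_closed neg_neg)
  thus ?thesis using assms * by (simp add: mul_assoc)
qed

lemma comm_group_chang: "comm_group chang_group"
proof (rule comm_groupI)
  fix p q r
  show "\<one>\<^bsub>chang_group\<^esub> \<in> carrier chang_group"
    by (simp add: chang_group_def bot_ne_top)
  assume p: "p \<in> carrier chang_group"
  show "\<one>\<^bsub>chang_group\<^esub> \<otimes>\<^bsub>chang_group\<^esub> p = p"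
    using p by (cases p) (auto simp: chang_group_def)
  show "\<exists>q\<in>carrier chang_group. q \<otimes>\<^bsub>chang_group\<^esub> p = \<one>\<^bsub>chang_group\<^esub>"
  proof -
    obtain m a where pm: "p = (m, a)" "a \<in> C" "a \<noteq> \<^bold>1" using p by (cases p) (auto simp: chang_group_def)
    show ?thesis
    proof (cases "a = \<^bold>0")
      case True
      thus ?thesis using pm bot_ne_top by (intro bexI [of _ "(- m, \<^bold>0)"]) (auto simp: chang_group_def)
    next
      case False
      hence "\<sim> a \<noteq> \<^bold>1" using pm by (metis bot_closed neg_neg)
      \<comment> \<open>Adding the complement to \<open>a\<close> carries, hence the extra
        \<open>- 1\<close>.\<close>
      thus ?thesis using pm by (intro bexI [of _ "(- m - 1, \<sim> a)"]) (auto simp: chang_group_def mul_def add_comm)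
    qed
  qed
  assume q: "q \<in> carrier chang_group"
  show "p \<otimes>\<^bsub>chang_group\<^esub> q \<in> carrier chang_group"
    using p q by (cases p; cases q) (auto simp: chang_group_def mul_ne_top)
  show "p \<otimes>\<^bsub>chang_group\<^esub> q = q \<otimes>\<^bsub>chang_group\<^esub> p"
    using p q by (cases p; cases q) (auto simp: chang_group_def add_comm mul_comm)
  assume r: "r \<in> carrier chang_group"
  show "p \<otimes>\<^bsub>chang_group\<^esub> q \<otimes>\<^bsub>chang_group\<^esub> r = p \<otimes>\<^bsub>chang_group\<^esub> (q \<otimes>\<^bsub>chang_group\<^esub> r)"
    using p q r by (cases p; cases q; cases r) (simp add: chang_group_def carry_add_assoc del: carry_add.simps)
qed

text \<open>The top element is not a fractional part and becomes the integer 1. Arguments outside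
  \<open>C\<close> default to 0, so that the free group on the whole type can be mapped to Chang's
  group.\<close>

definition unit_embed :: "'a \<Rightarrow> int \<times> 'a" where
  "unit_embed x = (if x \<notin> C then (0, \<^bold>0) else if x = \<^bold>1 then (1, \<^bold>0) else (0, x))"

text \<open>The order of Chang's group is pulled back along a homomorphism from a free abelian group
  to a total cone; elimination then transfers to the reals all comparisons between sums of two
  relevant elements.\<close>

lemma local_embedding:
  assumes V: "finite V" "V \<subseteq> C"
  obtains r :: "'a \<Rightarrow> real" where "inj_on r V" "r \<^bold>0 = 0" "\<And>x. x \<in> V \<Longrightarrow> 0 \<le> r x \<and> r x \<le> 1"
    "\<And>x y. x \<in> V \<Longrightarrow> y \<in> V \<Longrightarrow> r (x \<boxplus> y) = min 1 (r x + r y)"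
    "\<And>x. x \<in> V \<Longrightarrow> r (\<sim> x) = 1 - r x"
proof -
  interpret G: comm_group chang_group by (rule comm_group_chang)
  have car: "p \<in> carrier chang_group \<longleftrightarrow> snd p \<in> C \<and> snd p \<noteq> \<^bold>1" for p
    by (cases p) (auto simp: chang_group_def)
  have gadd: "p \<otimes>\<^bsub>chang_group\<^esub> q = carry_add p q" and gone: "\<one>\<^bsub>chang_group\<^esub> = (0, \<^bold>0)" for p q
    by (auto simp: chang_group_def)
  have emb_car: "unit_embed ` UNIV \<subseteq> carrier chang_group"
    using bot_ne_top by (auto simp: unit_embed_def car)
  have "\<exists>h \<in> hom (free_Abelian_group UNIV) chang_group. \<forall>x. h (frag_of x) = unit_embed x"
    by (rule G.free_Abelian_group_universal [OF emb_car]) auto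
  then obtain h where h: "h \<in> hom (free_Abelian_group UNIV) chang_group"
    and h_of: "\<And>x. h (frag_of x) = unit_embed x"
    by blast
  have h_add: "h (f + g) = carry_add (h f) (h g)" for f g
    using hom_mult [OF h, of f g] by (simp add: gadd)
  have h_car: "h f \<in> carrier chang_group" for f
    using hom_in_carrier [OF h, of f] by simp
  have hC: "snd (h f) \<in> C" "snd (h f) \<noteq> \<^bold>1" for f
    using h_car [of f] by (auto simp: car)
  have h_zero: "h 0 = (0, \<^bold>0)"
    using hom_one [OF h group_free_Abelian_group G.is_group] by (simp add: gone)
  \<comment> \<open>An element of Chang's group is nonnegative iff its integer part is.\<close>
  define K where "K = {f. 0 \<le> fst (h f)}"
  have fst_add: "fst (carry_add p q) = fst p + fst q \<or> fst (carry_add p q) = fst p + fst q + 1" for p q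
    by (cases p; cases q) auto
  interpret K: total_cone K
  proof
    show "f + g \<in> K" if "f \<in> K" "g \<in> K" for f g
      using that fst_add [of "h f" "h g"] by (auto simp: K_def h_add)
    \<comment> \<open>The integer parts of \<open>f\<close> and \<open>- f\<close> add up to 0 or
      -1, so they are not both negative.\<close>
    show "f \<in> K \<or> - f \<in> K" for f
    proof -
      have "carry_add (h f) (h (- f)) = (0, \<^bold>0)" using h_add [of f "- f"] h_zero by simp
      thus ?thesis using fst_add [of "h f" "h (- f)"] by (auto simp: K_def)
    qed
  qed
  \<comment> \<open>Subtracting an integer causes no carry.\<close>
  have fst_diff: "fst (h (f - g)) = fst (h f) - k" if "h g = (k, \<^bold>0)" for f g k
    using h_add [of "f - g" g] hC [of "f - g"] that by (cases "h (f - g)") auto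
  have eq_iff: "f - g \<in> K \<and> g - f \<in> K \<longleftrightarrow> h f = h g" for f g
  proof
    assume "h f = h g"
    hence "h (f - g) \<otimes>\<^bsub>chang_group\<^esub> h g = h g" "h (g - f) \<otimes>\<^bsub>chang_group\<^esub> h g = h g"
      using h_add [of "f - g" g] h_add [of "g - f" f] by (simp_all add: gadd)
    hence "h (f - g) = \<one>\<^bsub>chang_group\<^esub>" "h (g - f) = \<one>\<^bsub>chang_group\<^esub>"
      using h_car by (simp_all only: G.r_cancel_one)
    thus "f - g \<in> K \<and> g - f \<in> K" by (simp add: K_def gone)
  next
    assume *: "f - g \<in> K \<and> g - f \<in> K"
    obtain m a n b where ab: "h (f - g) = (m, a)" "h (g - f) = (n, b)" by fastforce
    have C: "a \<in> C" "b \<in> C" using ab hC by (metis snd_conv)+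
    have "carry_add (m, a) (n, b) = (0, \<^bold>0)"
      using h_add [of "f - g" "g - f"] h_zero ab by simp
    \<comment> \<open>Nonnegative integer parts leave no room for a carry in a total of 0.\<close>
    hence "m = 0 \<and> a \<boxplus> b = \<^bold>0"
      using * ab by (auto simp: K_def split: if_splits)
    hence "m = 0 \<and> a = \<^bold>0" using C le_add1 [of a b] by (simp add: le_bot_iff)
    thus "h f = h g"
      using h_add [of "f - g" g] ab hC [of g] by (cases "h g") auto
  qed

  define V' where "V' = V \<union> {\<^bold>0, \<^bold>1} \<union> (\<lambda>(x, y). x \<boxplus> y) ` (V \<times> V) \<union> neg ` V"
  have V': "finite V'" "V' \<subseteq> C" "\<^bold>0 \<in> V'" "\<^bold>1 \<in> V'" "V \<subseteq> V'"
    "\<And>x y. x \<in> V \<Longrightarrow> y \<in> V \<Longrightarrow> x \<boxplus> y \<in> V'" "\<And>x. x \<in> V \<Longrightarrow> \<sim> x \<in> V'"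
    using V by (auto simp: V'_def)
  let ?A = "\<lambda>a b. frag_of a + frag_of b"
  \<comment> \<open>Two-term sums suffice: \<open>a + b\<close> is compared with
    \<open>(a \<boxplus> b) + 0\<close> or \<open>1 + 0\<close>, and \<open>a + \<sim> a\<close>
    with \<open>1 + 0\<close>.\<close>
  define L where "L = (\<lambda>(a, b, c, d). ?A a b - ?A c d) ` (V' \<times> V' \<times> V' \<times> V')"
  have "finite L" using V' by (simp add: L_def)
  moreover have "Poly_Mapping.keys f \<subseteq> V'" if "f \<in> L" for f
    using that by (auto simp: L_def in_keys_iff lookup_minus lookup_add split: if_splits)
  ultimately have "\<exists>x. \<forall>f\<in>L. f \<in> K \<longleftrightarrow> 0 \<le> lin_form V' x f"
    by (rule K.fourier_motzkin [OF V'(1)])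
  then obtain x where x: "\<forall>f\<in>L. f \<in> K \<longleftrightarrow> 0 \<le> lin_form V' x f" ..
  have cmp: "?A a b - ?A c d \<in> K \<longleftrightarrow> x c + x d \<le> x a + x b" if "a \<in> V'" "b \<in> V'" "c \<in> V'" "d \<in> V'" for a b c d
  proof -
    have delta: "(\<Sum>i\<in>V'. of_int (if i = e then 1 else 0) * x i) = x e" if "e \<in> V'" for e
    proof -
      have "(\<Sum>i\<in>V'. of_int (if i = e then 1 else 0) * x i) = (\<Sum>i\<in>V'. if i = e then x i else 0)"
        by (rule sum.cong) auto
      thus ?thesis using V'(1) that by simp
    qed
    have "lin_form V' x (?A a b - ?A c d) = x a + x b - (x c + x d)"
      using that by (simp add: lookup_minus lookup_add distrib_right left_diff_distrib sum.distrib sum_subtractf delta)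
    moreover have "?A a b - ?A c d \<in> L" using that by (force simp: L_def)
    ultimately show ?thesis using x by simp
  qed
  have cmp_eq: "x a + x b = x c + x d \<longleftrightarrow> h (?A a b) = h (?A c d)" if "a \<in> V'" "b \<in> V'" "c \<in> V'" "d \<in> V'" for a b c d
    using cmp [of a b c d] cmp [of c d a b] eq_iff [of "?A a b" "?A c d"] that by auto
  have emb [simp]: "unit_embed \<^bold>0 = (0, \<^bold>0)" "unit_embed \<^bold>1 = (1, \<^bold>0)"
    using bot_ne_top by (auto simp: unit_embed_def)
  have hA: "h (?A a b) = carry_add (unit_embed a) (unit_embed b)" for a b
    by (simp add: h_add h_of)
  have hA0 [simp]: "h (?A a \<^bold>0) = unit_embed a" for a
    using bot_ne_top by (auto simp: hA unit_embed_def)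
  define \<delta> where "\<delta> = x \<^bold>1 - x \<^bold>0"
  \<comment> \<open>In Chang's group this difference is -1.\<close>
  have "?A \<^bold>0 \<^bold>0 - ?A \<^bold>1 \<^bold>0 \<notin> K"
    using fst_diff [of "?A \<^bold>1 \<^bold>0" 1 "?A \<^bold>0 \<^bold>0"] by (simp add: K_def)
  hence \<delta>: "\<delta> > 0" using cmp [of "\<^bold>0" "\<^bold>0" "\<^bold>1" "\<^bold>0"] V' by (simp add: \<delta>_def)
  \<comment> \<open>Only sums of two terms were compared, so \<open>x\<close> is fixed up to an affine change.\<close>
  define r where "r a = (x a - x \<^bold>0) / \<delta>" for a
  have nonneg: "0 \<le> r a" if "a \<in> V'" for a
  proof -
    have "0 \<le> fst (unit_embed a)" by (simp add: unit_embed_def)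
    hence "?A a \<^bold>0 - ?A \<^bold>0 \<^bold>0 \<in> K"
      using fst_diff [of "?A \<^bold>0 \<^bold>0" 0 "?A a \<^bold>0"] by (simp add: K_def)
    thus ?thesis using cmp [of a "\<^bold>0" "\<^bold>0" "\<^bold>0"] V' that \<delta> by (simp add: r_def)
  qed
  have neg: "r (\<sim> a) = 1 - r a" if "a \<in> V" for a
  proof -
    have "a \<in> C" using that V by blast
    moreover have "\<sim> a = \<^bold>1 \<longleftrightarrow> a = \<^bold>0" using calculation by (metis bot_closed neg_neg)
    ultimately have "h (?A a (\<sim> a)) = h (?A \<^bold>1 \<^bold>0)"
      using bot_ne_top by (auto simp: hA unit_embed_def mul_def)
    hence "x a + x (\<sim> a) = x \<^bold>1 + x \<^bold>0"
      using cmp_eq [of a "\<sim> a" "\<^bold>1" "\<^bold>0"] V' that by auto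
    thus ?thesis using \<delta> unfolding r_def by (simp add: field_simps) (simp add: \<delta>_def)
  qed
  have one: "r \<^bold>1 = 1" using \<delta> by (simp add: r_def \<delta>_def)
  have add: "r (a \<boxplus> b) = min 1 (r a + r b)" if ab: "a \<in> V" "b \<in> V" for a b
  proof -
    have C: "a \<in> C" "b \<in> C" "a \<in> V'" "b \<in> V'" using ab V V' by auto
    show ?thesis
    proof (cases "a \<boxplus> b = \<^bold>1")
      case True
      have "1 \<le> fst (h (?A a b))"
        using C True by (auto simp: hA unit_embed_def)
      hence "?A a b - ?A \<^bold>1 \<^bold>0 \<in> K"
        using fst_diff [of "?A \<^bold>1 \<^bold>0" 1 "?A a b"] by (simp add: K_def)
      hence "x \<^bold>1 + x \<^bold>0 \<le> x a + x b"
        using cmp [of a b "\<^bold>1" "\<^bold>0"] C V' by simp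
      hence "\<delta> \<le> (x a - x \<^bold>0) + (x b - x \<^bold>0)" by (simp add: \<delta>_def)
      hence "1 \<le> r a + r b" using \<delta> by (simp add: r_def flip: add_divide_distrib)
      thus ?thesis using True one by simp
    next
      case False
      hence "a \<noteq> \<^bold>1" "b \<noteq> \<^bold>1" using C by auto
      hence "h (?A a b) = h (?A (a \<boxplus> b) \<^bold>0)"
        using False C bot_ne_top by (simp add: hA unit_embed_def)
      hence "x a + x b = x (a \<boxplus> b) + x \<^bold>0"
        using cmp_eq [of a b "a \<boxplus> b" "\<^bold>0"] C V' ab by simp
      hence eq: "r (a \<boxplus> b) = r a + r b" by (simp add: r_def flip: add_divide_distrib)
      have "?A \<^bold>1 \<^bold>0 - ?A (a \<boxplus> b) \<^bold>0 \<in> K"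
      proof (rule ccontr)
        assume "\<not> ?thesis"
        hence "?A (a \<boxplus> b) \<^bold>0 - ?A \<^bold>1 \<^bold>0 \<in> K"
          using K.cone_total [of "?A \<^bold>1 \<^bold>0 - ?A (a \<boxplus> b) \<^bold>0"] by simp
        moreover have "unit_embed (a \<boxplus> b) = (0, a \<boxplus> b)" using False C by (simp add: unit_embed_def)
        ultimately show False
          using fst_diff [of "?A \<^bold>1 \<^bold>0" 1 "?A (a \<boxplus> b) \<^bold>0"] by (simp add: K_def)
      qed
      hence "r (a \<boxplus> b) \<le> 1"
        using cmp [of "\<^bold>1" "\<^bold>0" "a \<boxplus> b" "\<^bold>0"] V' ab \<delta> by (simp add: r_def \<delta>_def)
      thus ?thesis using eq by simp
    qed
  qed
  have inj: "inj_on r V"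
  proof (rule inj_onI)
    fix a b assume ab: "a \<in> V" "b \<in> V" "r a = r b"
    hence "x a + x \<^bold>0 = x b + x \<^bold>0" using \<delta> by (simp add: r_def)
    hence "unit_embed a = unit_embed b"
      using cmp_eq [of a "\<^bold>0" b "\<^bold>0"] ab V' by auto
    thus "a = b" using ab V bot_ne_top by (auto simp: unit_embed_def split: if_splits)
  qed
  have zero: "r \<^bold>0 = 0" by (simp add: r_def)
  have unit: "0 \<le> r a \<and> r a \<le> 1" if "a \<in> V" for a
    using nonneg [of a] nonneg [of "\<sim> a"] neg [of a] V' that by auto
  show ?thesis by (rule that [OF inj zero unit add neg])
qed

end

section \<open>MV-terms and Chang's completeness theorem\<close>

datatype mv_term = MVar nat | MZero | MAdd mv_term mv_term | MNeg mv_term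

primrec mv_eval :: "('a \<Rightarrow> 'a \<Rightarrow> 'a) \<Rightarrow> ('a \<Rightarrow> 'a) \<Rightarrow> 'a \<Rightarrow> (nat \<Rightarrow> 'a) \<Rightarrow> mv_term \<Rightarrow> 'a" where
  "mv_eval add neg z \<sigma> (MVar n) = \<sigma> n"
| "mv_eval add neg z \<sigma> MZero = z"
| "mv_eval add neg z \<sigma> (MAdd t u) = add (mv_eval add neg z \<sigma> t) (mv_eval add neg z \<sigma> u)"
| "mv_eval add neg z \<sigma> (MNeg t) = neg (mv_eval add neg z \<sigma> t)"

abbreviation real_eval :: "(nat \<Rightarrow> real) \<Rightarrow> mv_term \<Rightarrow> real" where
  "real_eval \<equiv> mv_eval (\<lambda>a b. min 1 (a + b)) (\<lambda>a. 1 - a) 0"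

definition real_valid :: "mv_term \<Rightarrow> mv_term \<Rightarrow> bool" where
  "real_valid t s \<longleftrightarrow> (\<forall>\<tau>. (\<forall>n. 0 \<le> \<tau> n \<and> \<tau> n \<le> 1) \<longrightarrow> real_eval \<tau> t = real_eval \<tau> s)"

primrec mv_subterms :: "mv_term \<Rightarrow> mv_term set" where
  "mv_subterms (MVar n) = {MVar n}"
| "mv_subterms MZero = {MZero}"
| "mv_subterms (MAdd t u) = insert (MAdd t u) (mv_subterms t \<union> mv_subterms u)"
| "mv_subterms (MNeg t) = insert (MNeg t) (mv_subterms t)"

lemma finite_mv_subterms [simp]: "finite (mv_subterms t)"
  by (induction t) auto

lemma self_in_mv_subterms [simp]: "t \<in> mv_subterms t"
  by (cases t) auto

lemma (in mv_algebra) mv_eval_closed: "range \<sigma> \<subseteq> C \<Longrightarrow> mv_eval add neg bot \<sigma> t \<in> C"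
  by (induction t) auto

text \<open>The subterms of both sides take finitely many values, and the local embedding is
  injective on them, so equality of the real values is reflected back.\<close>

lemma (in mv_chain) chang_chain:
  assumes \<sigma>: "range \<sigma> \<subseteq> C" and valid: "real_valid t s"
  shows "mv_eval add neg bot \<sigma> t = mv_eval add neg bot \<sigma> s"
proof -
  let ?e = "mv_eval add neg bot \<sigma>"
  define M where "M = mv_subterms t \<union> mv_subterms s"
  have "finite (?e ` M)" "?e ` M \<subseteq> C"
    using \<sigma> mv_eval_closed by (auto simp: M_def)
  then obtain r :: "'a \<Rightarrow> real" where r: "inj_on r (?e ` M)" "r \<^bold>0 = 0"
    "\<And>x. x \<in> ?e ` M \<Longrightarrow> 0 \<le> r x \<and> r x \<le> 1"
    "\<And>x y. x \<in> ?e ` M \<Longrightarrow> y \<in> ?e ` M \<Longrightarrow> r (x \<boxplus> y) = min 1 (r x + r y)"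
    "\<And>x. x \<in> ?e ` M \<Longrightarrow> r (\<sim> x) = 1 - r x"
    using local_embedding [of "?e ` M"] by blast
  \<comment> \<open>Clamping changes values only at variables outside the two terms, where
    \<open>r\<close> is unconstrained.\<close>
  define \<tau> where "\<tau> n = max 0 (min 1 (r (\<sigma> n)))" for n
  have hom: "r (?e u) = real_eval \<tau> u" if "mv_subterms u \<subseteq> M" for u
    using that
  proof (induction u)
    case (MVar n)
    hence "\<sigma> n \<in> ?e ` M" by force
    thus ?case using r(3) [of "\<sigma> n"] by (simp add: \<tau>_def)
  next
    case (MAdd u v)
    hence "u \<in> M" "v \<in> M" using self_in_mv_subterms by auto
    thus ?case using MAdd r(4) by simp
  next
    case (MNeg u)
    hence "u \<in> M" using self_in_mv_subterms by auto
    thus ?case using MNeg r(5) by simp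
  qed (simp add: r(2))
  have "real_eval \<tau> t = real_eval \<tau> s"
    using valid by (simp add: real_valid_def \<tau>_def)
  hence "r (?e t) = r (?e s)" using hom by (simp add: M_def)
  thus ?thesis using inj_onD [OF r(1), of "?e t" "?e s"] by (simp add: M_def)
qed

text \<open>Unequal values would stay unequal in some linearly ordered quotient, and
  \<open>q\<close> commutes with evaluation.\<close>

theorem (in mv_algebra) chang_completeness:
  assumes \<sigma>: "range \<sigma> \<subseteq> C" and valid: "real_valid t s"
  shows "mv_eval add neg bot \<sigma> t = mv_eval add neg bot \<sigma> s"
proof (rule ccontr)
  assume "\<not> ?thesis"
  then obtain q where q: "mv_chain (q ` C) (\<lambda>x y. q (x \<boxplus> y)) (\<lambda>x. q (\<sim> x)) (q \<^bold>0)"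
    and q_add: "\<And>x y. x \<in> C \<Longrightarrow> y \<in> C \<Longrightarrow> q (q x \<boxplus> q y) = q (x \<boxplus> y)"
    and q_neg: "\<And>x. x \<in> C \<Longrightarrow> q (\<sim> q x) = q (\<sim> x)"
    and ne: "q (mv_eval add neg bot \<sigma> t) \<noteq> q (mv_eval add neg bot \<sigma> s)"
    using chain_quotient mv_eval_closed [OF \<sigma>] by metis
  have "mv_eval (\<lambda>x y. q (x \<boxplus> y)) (\<lambda>x. q (\<sim> x)) (q \<^bold>0) (\<lambda>n. q (\<sigma> n)) u = q (mv_eval add neg bot \<sigma> u)" for u
    by (induction u) (simp_all add: q_add q_neg mv_eval_closed [OF \<sigma>])
  moreover have "range (\<lambda>n. q (\<sigma> n)) \<subseteq> q ` C" using \<sigma> by auto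
  ultimately show False
    using mv_chain.chang_chain [OF q _ valid, of "\<lambda>n. q (\<sigma> n)"] ne by simp
qed

section \<open>The square standard algebra\<close>

lemma Sstar_simps [simp]:
  "p \<in> car Sstar \<longleftrightarrow> -1 \<le> fst p \<and> fst p \<le> 1 \<and> -1 \<le> snd p \<and> snd p \<le> 1"
  "opl Sstar p q = (clip (fst p + fst q), 0)" "ng Sstar p = (- fst p, - snd p)"
  "pls Sstar p = (max 0 (fst p), 0)" "mns Sstar p = (min 0 (fst p), 0)"
  "zr Sstar = (0, 0)" "on Sstar = (1, 0)"
  by (simp_all add: Sstar_def)

lemma clip_bounds [simp]: "-1 \<le> clip r" "clip r \<le> 1"
  by (auto simp: clip_def)

lemma clip_id: "-1 \<le> r \<Longrightarrow> r \<le> 1 \<Longrightarrow> clip r = r"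
  by (simp add: clip_def)

lemma eval_Sstar_car: "(\<And>n. \<rho> n \<in> car Sstar) \<Longrightarrow> eval Sstar \<rho> t \<in> car Sstar"
  by (induction t) auto

text \<open>The join adds truncated differences to positive and negative parts separately; on the
  first coordinates the two contributions add up to the maximum.\<close>

lemma qjoin_Sstar:
  assumes "p \<in> car Sstar" "q \<in> car Sstar"
  shows "qjoin Sstar p q = (max (fst p) (fst q), 0)"
proof -
  have "clip (clip (max 0 a + max 0 (clip (max 0 b - max 0 a))) +
      clip (min 0 a + max 0 (clip (min 0 b - min 0 a)))) = max a b"
    if "-1 \<le> a" "a \<le> 1" "-1 \<le> b" "b \<le> 1" for a b
    using that by (cases "0 \<le> a"; cases "0 \<le> b"; cases "a \<le> b") (simp_all add: clip_id)
  thus ?thesis using assms by (simp add: qjoin_def)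
qed

lemma is_sqmv_Sstar: "is_sqmv Sstar"
  unfolding is_sqmv_def is_qmv_def
proof (intro conjI ballI)
  fix x y z assume xyz: "x \<in> car Sstar" "y \<in> car Sstar" "z \<in> car Sstar"
  obtain a a' b b' c c' where [simp]: "x = (a, a')" "y = (b, b')" "z = (c, c')" by fastforce
  have abc: "-1 \<le> a" "a \<le> 1" "-1 \<le> b" "b \<le> 1" "-1 \<le> c" "c \<le> 1" using xyz by auto
  let ?p = "opl Sstar"
  have "clip (clip (1 + a) + clip (b + clip (1 + c))) = clip (clip (clip (1 + a) + b) + clip (1 + c))"
    using abc unfolding clip_def by (smt (verit))
  thus "?p (?p (on Sstar) x) (?p y (?p (on Sstar) z)) = ?p (?p (?p (on Sstar) x) y) (?p (on Sstar) z)"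
    by simp
  have "clip (a + b) = clip (clip (max 0 a + max 0 b) + clip (min 0 a + min 0 b))"
    using abc by (cases "0 \<le> a"; cases "0 \<le> b") (auto simp: clip_def)
  thus "?p x y = ?p (?p (pls Sstar x) (pls Sstar y)) (?p (mns Sstar x) (mns Sstar y))"
    by simp
  have "max 0 (clip (clip (a + b) - a)) = clip (clip (max 0 a + max 0 b) - max 0 a)"
    using abc by (cases "0 \<le> a"; cases "0 \<le> b") (auto simp: clip_def)
  thus "pls Sstar (?p (ng Sstar x) (?p x y)) = ?p (ng Sstar (pls Sstar x)) (?p (pls Sstar x) (pls Sstar y))"
    by simp
  show "qjoin Sstar x y = qjoin Sstar y x"
    using xyz by (simp add: qjoin_Sstar max.commute)
  have "qjoin Sstar x y \<in> car Sstar" "qjoin Sstar y z \<in> car Sstar"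
    using xyz by (auto simp: qjoin_Sstar)
  thus "qjoin Sstar x (qjoin Sstar y z) = qjoin Sstar (qjoin Sstar x y) z"
    using xyz by (simp add: qjoin_Sstar max.assoc)
  have "clip (a + max b c) = max (clip (a + b)) (clip (a + c))"
    by (auto simp: clip_def)
  thus "?p x (qjoin Sstar y z) = qjoin Sstar (?p x y) (?p x z)"
    using xyz by (simp add: qjoin_Sstar)
qed (auto simp: clip_def)

section \<open>Copying a subalgebra along an injection\<close>

definition qmv_laws :: "('a, 'b) qalg_scheme \<Rightarrow> 'a \<Rightarrow> 'a \<Rightarrow> 'a \<Rightarrow> bool" where
  "qmv_laws A x y z \<longleftrightarrow>
      opl A x y = opl A y x \<and>
      opl A (opl A (on A) x) (opl A y (opl A (on A) z))
        = opl A (opl A (opl A (on A) x) y) (opl A (on A) z) \<and>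
      opl A (opl A x (on A)) (on A) = on A \<and>
      opl A (opl A x y) (zr A) = opl A x y \<and>
      opl A (pls A x) (zr A) = pls A (opl A x (zr A)) \<and>
      pls A (opl A x (zr A)) = opl A (on A) (opl A (ng A (on A)) x) \<and>
      opl A (mns A x) (zr A) = mns A (opl A x (zr A)) \<and>
      mns A (opl A x (zr A)) = opl A (ng A (on A)) (opl A (on A) x) \<and>
      opl A x y = opl A (opl A (pls A x) (pls A y)) (opl A (mns A x) (mns A y)) \<and>
      zr A = ng A (zr A) \<and>
      opl A x (ng A x) = zr A \<and>
      ng A (opl A x y) = opl A (ng A x) (ng A y) \<and>
      ng A (ng A x) = x \<and>
      pls A (opl A (ng A x) (opl A x y))
        = opl A (ng A (pls A x)) (opl A (pls A x) (pls A y)) \<and>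
      qjoin A x y = qjoin A y x \<and>
      qjoin A x (qjoin A y z) = qjoin A (qjoin A x y) z \<and>
      opl A x (qjoin A y z) = qjoin A (opl A x y) (opl A x z)"

text \<open>Isolating the laws as a relation on three elements lets them be transported pointwise
  along an injection.\<close>

lemma is_qmv_iff_laws:
  "is_qmv A \<longleftrightarrow> zr A \<in> car A \<and> on A \<in> car A \<and>
    (\<forall>x\<in>car A. \<forall>y\<in>car A. opl A x y \<in> car A) \<and>
    (\<forall>x\<in>car A. ng A x \<in> car A \<and> pls A x \<in> car A \<and> mns A x \<in> car A) \<and>
    (\<forall>x\<in>car A. \<forall>y\<in>car A. \<forall>z\<in>car A. qmv_laws A x y z)"
  unfolding is_qmv_def qmv_laws_def ..

definition transport :: "('a \<Rightarrow> 'c) \<Rightarrow> 'a set \<Rightarrow> ('a, 'b) qalg_scheme \<Rightarrow> 'c qalg" where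
  "transport f T A = (let g = inv_into T f in
     \<lparr>car = f ` T, opl = (\<lambda>x y. f (opl A (g x) (g y))), ng = (\<lambda>x. f (ng A (g x))),
      pls = (\<lambda>x. f (pls A (g x))), mns = (\<lambda>x. f (mns A (g x))), zr = f (zr A), on = f (on A)\<rparr>)"

locale subalgebra_copy =
  fixes f :: "'a \<Rightarrow> 'c" and T :: "'a set" and A :: "('a, 'b) qalg_scheme"
  assumes inj: "inj_on f T" and sub: "T \<subseteq> car A"
    and T_closed [simp]: "zr A \<in> T" "on A \<in> T" "x \<in> T \<Longrightarrow> y \<in> T \<Longrightarrow> opl A x y \<in> T"
      "x \<in> T \<Longrightarrow> ng A x \<in> T" "x \<in> T \<Longrightarrow> pls A x \<in> T" "x \<in> T \<Longrightarrow> mns A x \<in> T"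
begin

abbreviation B :: "'c qalg" where "B \<equiv> transport f T A"

lemma B_simps [simp]:
  "car B = f ` T" "zr B = f (zr A)" "on B = f (on A)"
  "x \<in> T \<Longrightarrow> y \<in> T \<Longrightarrow> opl B (f x) (f y) = f (opl A x y)"
  "x \<in> T \<Longrightarrow> ng B (f x) = f (ng A x)" "x \<in> T \<Longrightarrow> pls B (f x) = f (pls A x)"
  "x \<in> T \<Longrightarrow> mns B (f x) = f (mns A x)"
  using inj by (simp_all add: transport_def Let_def)

lemma qjoin_closed [simp]: "x \<in> T \<Longrightarrow> y \<in> T \<Longrightarrow> qjoin A x y \<in> T"
  by (simp add: qjoin_def)

lemma qjoin_B [simp]: "x \<in> T \<Longrightarrow> y \<in> T \<Longrightarrow> qjoin B (f x) (f y) = f (qjoin A x y)"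
  by (simp add: qjoin_def)

lemma is_sqmv_B:
  assumes "is_sqmv A"
  shows "is_sqmv B"
proof -
  have q: "is_qmv A" and s: "\<And>x. x \<in> car A \<Longrightarrow> pls A x = opl A (pls A x) (zr A) \<and> mns A x = opl A (mns A x) (zr A)"
    using assms by (auto simp: is_sqmv_def)
  have laws: "\<forall>x\<in>T. \<forall>y\<in>T. \<forall>z\<in>T. qmv_laws A x y z"
    using q sub unfolding is_qmv_iff_laws by blast
  have "qmv_laws B (f x) (f y) (f z) \<longleftrightarrow> qmv_laws A x y z" if "x \<in> T" "y \<in> T" "z \<in> T" for x y z
    using that by (simp only: qmv_laws_def B_simps T_closed qjoin_B qjoin_closed inj_on_eq_iff [OF inj])
  hence "is_qmv B"
    using laws unfolding is_qmv_iff_laws by simp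
  moreover have "pls B x = opl B (pls B x) (zr B) \<and> mns B x = opl B (mns B x) (zr B)" if "x \<in> car B" for x
  proof -
    from that obtain x' where x': "x' \<in> T" "x = f x'" by auto
    hence "x' \<in> car A" using sub by blast
    from s [OF this] show ?thesis using x' by simp
  qed
  ultimately show ?thesis by (simp only: is_sqmv_def) blast
qed

lemma eval_B: "(\<And>n. \<rho> n \<in> T) \<Longrightarrow> eval B (\<lambda>n. f (\<rho> n)) t = f (eval A \<rho> t) \<and> eval A \<rho> t \<in> T"
  by (induction t) auto

end

instance tm :: countable
  by countable_datatype

text \<open>The type may be countable, so the whole square need not fit into it. A single
  assignment, however, reaches only the values of terms, and there are countably many terms.\<close>

theorem holds_Sstar_of_SQMV_holds:
  assumes "SQMV_holds TYPE('a::infinite) t s"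
  shows "holds Sstar t s"
  unfolding holds_def
proof (intro allI impI)
  fix \<rho> :: "nat \<Rightarrow> real \<times> real"
  assume \<rho>: "\<forall>n. \<rho> n \<in> car Sstar"
  define T where "T = range (eval Sstar \<rho>)" \<comment> \<open>the subalgebra generated by the values of \<open>\<rho>\<close>\<close>
  have "countable T" by (simp add: T_def)
  moreover obtain g :: "nat \<Rightarrow> 'a" where "inj g"
    using infinite_UNIV infinite_countable_subset by blast
  ultimately have inj: "inj_on (g \<circ> to_nat_on T) T"
    by (meson comp_inj_on inj_on_subset inj_on_to_nat_on subset_UNIV)
  have range: "x \<in> T" if "eval Sstar \<rho> u = x" for u x using that by (auto simp: T_def)
  interpret subalgebra_copy "g \<circ> to_nat_on T" T Sstar
  proof
    show "inj_on (g \<circ> to_nat_on T) T" by fact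
    show "T \<subseteq> car Sstar" using eval_Sstar_car \<rho> unfolding T_def by blast
    show "zr Sstar \<in> T" by (rule range [of Zero]) simp
    show "on Sstar \<in> T" by (rule range [of One]) simp
    fix x assume "x \<in> T"
    then obtain u where u: "x = eval Sstar \<rho> u" by (auto simp: T_def)
    show "ng Sstar x \<in> T" by (rule range [of "Neg u"]) (simp add: u)
    show "pls Sstar x \<in> T" by (rule range [of "Pl u"]) (simp add: u)
    show "mns Sstar x \<in> T" by (rule range [of "Mn u"]) (simp add: u)
    fix y assume "y \<in> T"
    then obtain v where v: "y = eval Sstar \<rho> v" by (auto simp: T_def)
    show "opl Sstar x y \<in> T" by (rule range [of "Oplus u v"]) (simp add: u v)
  qed
  have \<rho>T: "\<rho> n \<in> T" for n by (rule range [of "Var n"]) simp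
  have "holds B t s"
    using assms is_sqmv_B [OF is_sqmv_Sstar] by (simp add: SQMV_holds_def)
  hence "eval B (\<lambda>n. (g \<circ> to_nat_on T) (\<rho> n)) t = eval B (\<lambda>n. (g \<circ> to_nat_on T) (\<rho> n)) s"
    using \<rho>T by (simp add: holds_def del: o_apply)
  thus "eval Sstar \<rho> t = eval Sstar \<rho> s"
    using eval_B [of \<rho> t] eval_B [of \<rho> s] \<rho>T inj by (simp add: inj_on_eq_iff del: o_apply)
qed

section \<open>The positive part of a strong quasi-MV* algebra\<close>

locale sqmv_algebra =
  fixes A :: "('a, 'b) qalg_scheme"
  assumes sqmv: "is_sqmv A"
begin

abbreviation add :: "'a \<Rightarrow> 'a \<Rightarrow> 'a" (infixl \<open>\<boxplus>\<close> 65) where "x \<boxplus> y \<equiv> opl A x y"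
abbreviation neg :: "'a \<Rightarrow> 'a" (\<open>\<sim> _\<close> [80] 80) where "\<sim> x \<equiv> ng A x"
abbreviation zero :: 'a (\<open>\<^bold>0\<close>) where "\<^bold>0 \<equiv> zr A"
abbreviation one :: 'a (\<open>\<^bold>1\<close>) where "\<^bold>1 \<equiv> on A"
abbreviation pos :: "'a \<Rightarrow> 'a" where "pos x \<equiv> pls A x"

lemma closed [simp]:
  "\<^bold>0 \<in> car A" "\<^bold>1 \<in> car A"
  "x \<in> car A \<Longrightarrow> y \<in> car A \<Longrightarrow> x \<boxplus> y \<in> car A"
  "x \<in> car A \<Longrightarrow> \<sim> x \<in> car A" "x \<in> car A \<Longrightarrow> pos x \<in> car A" "x \<in> car A \<Longrightarrow> mns A x \<in> car A"
  using sqmv unfolding is_sqmv_def is_qmv_def by blast+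

lemma
  assumes "x \<in> car A" "y \<in> car A" "z \<in> car A"
  shows ax_comm: "x \<boxplus> y = y \<boxplus> x"
    and ax_assoc: "(\<^bold>1 \<boxplus> x) \<boxplus> (y \<boxplus> (\<^bold>1 \<boxplus> z)) = ((\<^bold>1 \<boxplus> x) \<boxplus> y) \<boxplus> (\<^bold>1 \<boxplus> z)"
    and ax_one: "(x \<boxplus> \<^bold>1) \<boxplus> \<^bold>1 = \<^bold>1"
    and ax_zero: "(x \<boxplus> y) \<boxplus> \<^bold>0 = x \<boxplus> y"
    and ax_pos: "pos x \<boxplus> \<^bold>0 = pos (x \<boxplus> \<^bold>0)" "pos (x \<boxplus> \<^bold>0) = \<^bold>1 \<boxplus> (\<sim> \<^bold>1 \<boxplus> x)"
    and ax_mns: "mns A x \<boxplus> \<^bold>0 = mns A (x \<boxplus> \<^bold>0)" "mns A (x \<boxplus> \<^bold>0) = \<sim> \<^bold>1 \<boxplus> (\<^bold>1 \<boxplus> x)"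
    and ax_split: "x \<boxplus> y = (pos x \<boxplus> pos y) \<boxplus> (mns A x \<boxplus> mns A y)"
    and ax_neg_zero: "\<^bold>0 = \<sim> \<^bold>0"
    and ax_add_neg: "x \<boxplus> \<sim> x = \<^bold>0"
    and ax_neg_add: "\<sim> (x \<boxplus> y) = \<sim> x \<boxplus> \<sim> y"
    and ax_neg_neg: "\<sim> \<sim> x = x"
    and ax_join: "qjoin A x y = qjoin A y x"
    and ax_strong: "pos x = pos x \<boxplus> \<^bold>0" "mns A x = mns A x \<boxplus> \<^bold>0"
  using sqmv assms unfolding is_sqmv_def is_qmv_def by blast+

lemma neg_zero [simp]: "\<sim> \<^bold>0 = \<^bold>0"
  using ax_neg_zero [of "\<^bold>0" "\<^bold>0" "\<^bold>0"] by simp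

lemma neg_neg [simp]: "x \<in> car A \<Longrightarrow> \<sim> \<sim> x = x"
  using ax_neg_neg [of x x x] by simp

lemma comm: "x \<in> car A \<Longrightarrow> y \<in> car A \<Longrightarrow> x \<boxplus> y = y \<boxplus> x"
  using ax_comm [of x y x] by simp

lemma add_neg [simp]: "x \<in> car A \<Longrightarrow> x \<boxplus> \<sim> x = \<^bold>0"
  using ax_add_neg [of x x x] by simp

lemma neg_add_self [simp]: "x \<in> car A \<Longrightarrow> \<sim> x \<boxplus> x = \<^bold>0"
  using comm [of x "\<sim> x"] by simp

lemma neg_add: "x \<in> car A \<Longrightarrow> y \<in> car A \<Longrightarrow> \<sim> (x \<boxplus> y) = \<sim> x \<boxplus> \<sim> y"
  using ax_neg_add [of x y x] by simp

lemma add_zero_regular [simp]: "x \<in> car A \<Longrightarrow> y \<in> car A \<Longrightarrow> (x \<boxplus> y) \<boxplus> \<^bold>0 = x \<boxplus> y"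
  using ax_zero [of x y x] by simp

lemma zero_add_regular [simp]: "x \<in> car A \<Longrightarrow> y \<in> car A \<Longrightarrow> \<^bold>0 \<boxplus> (x \<boxplus> y) = x \<boxplus> y"
  using comm [of "\<^bold>0" "x \<boxplus> y"] by simp

lemma add_one_one: "x \<in> car A \<Longrightarrow> (x \<boxplus> \<^bold>1) \<boxplus> \<^bold>1 = \<^bold>1"
  using ax_one [of x x x] by simp

lemma one_add_zero [simp]: "\<^bold>1 \<boxplus> \<^bold>0 = \<^bold>1"
  using add_one_one [of "\<^bold>0"] add_zero_regular [of "\<^bold>0 \<boxplus> \<^bold>1" "\<^bold>1"] by simp

lemma zero_add_one [simp]: "\<^bold>0 \<boxplus> \<^bold>1 = \<^bold>1"
  using comm [of "\<^bold>0" "\<^bold>1"] by simp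

lemma one_add_one [simp]: "\<^bold>1 \<boxplus> \<^bold>1 = \<^bold>1"
  using add_one_one [of "\<^bold>0"] by simp

lemma neg_one_add_zero [simp]: "\<sim> \<^bold>1 \<boxplus> \<^bold>0 = \<sim> \<^bold>1"
  using neg_add [of "\<^bold>1" "\<^bold>0"] by simp

text \<open>Strongness removes the added 0 from the law for positive parts, so the positive part is
  itself a sum.\<close>

lemma pos_eq: "x \<in> car A \<Longrightarrow> pos x = \<^bold>1 \<boxplus> (\<sim> \<^bold>1 \<boxplus> x)"
  using ax_pos [of x x x] ax_strong [of x x x] by simp

lemma mns_eq: "x \<in> car A \<Longrightarrow> mns A x = \<sim> \<^bold>1 \<boxplus> (\<^bold>1 \<boxplus> x)"
  using ax_mns [of x x x] ax_strong [of x x x] by simp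

lemma mns_eq_neg_pos: "x \<in> car A \<Longrightarrow> mns A x = \<sim> pos (\<sim> x)"
  by (simp add: pos_eq mns_eq neg_add)

lemma pos_add_zero: "x \<in> car A \<Longrightarrow> pos (x \<boxplus> \<^bold>0) = pos x"
  using ax_pos [of x x x] ax_strong [of x x x] by simp

lemma one_assoc: "y \<in> car A \<Longrightarrow> z \<in> car A \<Longrightarrow> \<^bold>1 \<boxplus> (y \<boxplus> (\<^bold>1 \<boxplus> z)) = (\<^bold>1 \<boxplus> y) \<boxplus> (\<^bold>1 \<boxplus> z)"
  using ax_assoc [of "\<^bold>0" y z] by simp

lemma pos_one_add [simp]: "x \<in> car A \<Longrightarrow> pos (\<^bold>1 \<boxplus> x) = \<^bold>1 \<boxplus> x"
  using one_assoc [of "\<sim> \<^bold>1" x] by (simp add: pos_eq)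

lemma pos_pos [simp]: "x \<in> car A \<Longrightarrow> pos (pos x) = pos x"
  using pos_one_add [of "\<sim> \<^bold>1 \<boxplus> x"] by (simp add: pos_eq)

lemma pos_zero [simp]: "pos \<^bold>0 = \<^bold>0"
  by (simp add: pos_eq)

lemma pos_one [simp]: "pos \<^bold>1 = \<^bold>1"
  by (simp add: pos_eq)

definition positive :: "'a set" where "positive = {p \<in> car A. pos p = p}"

lemma positive_car: "p \<in> positive \<Longrightarrow> p \<in> car A"
  unfolding positive_def by simp

lemma pos_positive [simp]: "p \<in> positive \<Longrightarrow> pos p = p"
  unfolding positive_def by simp

lemma pos_in_positive [simp]: "x \<in> car A \<Longrightarrow> pos x \<in> positive"
  unfolding positive_def by simp

lemma one_add_positive [simp]: "x \<in> car A \<Longrightarrow> \<^bold>1 \<boxplus> x \<in> positive"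
  unfolding positive_def by simp

lemma positive_cases:
  assumes "p \<in> positive"
  obtains x where "x \<in> car A" "p = \<^bold>1 \<boxplus> x"
  using assms pos_eq [of p] that [of "\<sim> \<^bold>1 \<boxplus> p"] by (simp add: positive_car)

text \<open>Positive elements have the form \<open>1 + x\<close> that restricted associativity asks
  of the outer arguments. The middle argument stays arbitrary, which admits a negated element there
  in \<open>pos_sub\<close>.\<close>

lemma positive_assoc:
  assumes "p \<in> positive" "y \<in> car A" "q \<in> positive"
  shows "(p \<boxplus> y) \<boxplus> q = p \<boxplus> (y \<boxplus> q)"
  using assms(1,3) by (elim positive_cases) (simp add: ax_assoc assms(2))

lemma zero_positive [simp]: "\<^bold>0 \<in> positive" and one_positive [simp]: "\<^bold>1 \<in> positive"
  unfolding positive_def by simp_all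

lemma positive_add_zero [simp]: "p \<in> positive \<Longrightarrow> p \<boxplus> \<^bold>0 = p"
  by (elim positive_cases) simp

declare positive_car [simp]

lemma positive_add_one [simp]: "p \<in> positive \<Longrightarrow> p \<boxplus> \<^bold>1 = \<^bold>1"
  by (elim positive_cases) (simp add: add_one_one comm [of "\<^bold>1"])

lemma one_add_positive_eq [simp]: "p \<in> positive \<Longrightarrow> \<^bold>1 \<boxplus> p = \<^bold>1"
  using comm [of "\<^bold>1" p] by simp

lemma positive_add [simp]: "p \<in> positive \<Longrightarrow> q \<in> positive \<Longrightarrow> p \<boxplus> q \<in> positive"
  by (elim positive_cases) (simp flip: one_assoc)

lemma mns_positive [simp]: "p \<in> positive \<Longrightarrow> mns A p = \<^bold>0"
  by (simp add: mns_eq)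

lemma pos_neg_positive [simp]: "p \<in> positive \<Longrightarrow> pos (\<sim> p) = \<^bold>0"
  using comm [of p "\<^bold>1"] by (simp add: pos_eq flip: neg_add)

text \<open>The left side is truncated subtraction in the MV-signature. Reassociating around the
  middle term \<open>\<sim> p\<close> turns it into the sum that expresses a positive part.\<close>

lemma pos_sub:
  assumes "p \<in> positive" "q \<in> positive"
  shows "\<^bold>1 \<boxplus> \<sim> ((\<^bold>1 \<boxplus> \<sim> p) \<boxplus> q) = pos (p \<boxplus> \<sim> q)"
  using assms by (simp add: positive_assoc neg_add pos_eq)

text \<open>Negative parts vanish here, leaving the MV-join; commutativity of \<open>qjoin\<close>
  thereby becomes Lukasiewicz's axiom.\<close>

lemma qjoin_positive: "p \<in> positive \<Longrightarrow> q \<in> positive \<Longrightarrow> qjoin A q p = pos (p \<boxplus> \<sim> q) \<boxplus> q"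
  by (simp add: qjoin_def comm)

sublocale P: mv_algebra positive add "\<lambda>p. \<^bold>1 \<boxplus> \<sim> p" "\<^bold>0"
proof
  fix p q r
  assume p: "p \<in> positive"
  show "\<^bold>1 \<boxplus> \<sim> p \<in> positive" using p by simp
  show "p \<boxplus> \<^bold>0 = p" using p by simp
  show "\<^bold>1 \<boxplus> \<sim> (\<^bold>1 \<boxplus> \<sim> p) = p"
    using p pos_eq [of p] by (simp add: neg_add)
  show "p \<boxplus> (\<^bold>1 \<boxplus> \<sim> \<^bold>0) = \<^bold>1 \<boxplus> \<sim> \<^bold>0" using p by simp
  assume q: "q \<in> positive"
  show "p \<boxplus> q \<in> positive" using p q by simp
  show "p \<boxplus> q = q \<boxplus> p" using p q by (simp add: comm)
  show "(\<^bold>1 \<boxplus> \<sim> ((\<^bold>1 \<boxplus> \<sim> p) \<boxplus> q)) \<boxplus> q = (\<^bold>1 \<boxplus> \<sim> ((\<^bold>1 \<boxplus> \<sim> q) \<boxplus> p)) \<boxplus> p"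
    using p q qjoin_positive [of p q] qjoin_positive [of q p] ax_join [of p q p] by (simp add: pos_sub)
  assume "r \<in> positive"
  thus "(p \<boxplus> q) \<boxplus> r = p \<boxplus> (q \<boxplus> r)" using p q by (simp add: positive_assoc)
qed simp

text \<open>Expressing negative parts through \<open>pos\<close> makes every sum a difference of two
  positive elements, to which \<open>pos_sub\<close> applies.\<close>

lemma split_pos:
  assumes "x \<in> car A" "y \<in> car A"
  shows "x \<boxplus> y = (pos x \<boxplus> pos y) \<boxplus> \<sim> (pos (\<sim> x) \<boxplus> pos (\<sim> y))"
  using ax_split [of x y x] assms by (simp add: mns_eq_neg_pos neg_add)

lemma pos_neg_split:
  assumes "x \<in> car A"
  shows "x \<boxplus> \<^bold>0 = pos x \<boxplus> \<sim> pos (\<sim> x)"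
  using split_pos [of x "\<^bold>0"] assms by simp

end

section \<open>Translation of terms into pairs of MV-terms\<close>

abbreviation MSub :: "mv_term \<Rightarrow> mv_term \<Rightarrow> mv_term" where "MSub a b \<equiv> MNeg (MAdd (MNeg a) b)"

text \<open>
  The components compute \<open>x\<^sup>+\<close> and \<open>(-x)\<^sup>+\<close>. Two MV-variables stand for each variable; taking their
  truncated differences makes the two components disjoint under every assignment.
\<close>

primrec mv_translation :: "tm \<Rightarrow> mv_term \<times> mv_term" where
  "mv_translation (Var n) = (MSub (MVar (2 * n)) (MVar (2 * n + 1)), MSub (MVar (2 * n + 1)) (MVar (2 * n)))"
| "mv_translation Zero = (MZero, MZero)"
| "mv_translation One = (MNeg MZero, MZero)"
| "mv_translation (Oplus t u) =
    (MSub (MAdd (fst (mv_translation t)) (fst (mv_translation u))) (MAdd (snd (mv_translation t)) (snd (mv_translation u))),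
     MSub (MAdd (snd (mv_translation t)) (snd (mv_translation u))) (MAdd (fst (mv_translation t)) (fst (mv_translation u))))"
| "mv_translation (Neg t) = prod.swap (mv_translation t)"
| "mv_translation (Pl t) = (fst (mv_translation t), MZero)"
| "mv_translation (Mn t) = (MZero, snd (mv_translation t))"

context sqmv_algebra
begin

lemma eval_closed: "(\<And>n. \<rho> n \<in> car A) \<Longrightarrow> eval A \<rho> t \<in> car A"
  by (induction t) auto

text \<open>The numbering follows the two MV-variables that \<open>mv_translation\<close> reserves
  for each variable.\<close>

definition parts :: "(nat \<Rightarrow> 'a) \<Rightarrow> nat \<Rightarrow> 'a" where
  "parts \<rho> n = pos (if even n then \<rho> (n div 2) else \<sim> \<rho> (n div 2))"

lemma eval_translation:
  assumes \<rho>: "\<And>n. \<rho> n \<in> car A"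
  defines "e \<equiv> mv_eval add (\<lambda>p. \<^bold>1 \<boxplus> \<sim> p) \<^bold>0 (parts \<rho>)"
  shows "e (fst (mv_translation t)) = pos (eval A \<rho> t) \<and> e (snd (mv_translation t)) = pos (\<sim> eval A \<rho> t)"
proof (induction t)
  case (Var n)
  \<comment> \<open>The parts of one element are already disjoint: their signed difference is the
    element plus 0, and \<open>pos\<close> ignores the added 0. The truncated differences in the
    translation thus change nothing.\<close>
  have "pos (pos (\<rho> n) \<boxplus> \<sim> pos (\<sim> \<rho> n)) = pos (\<rho> n)"
    using pos_neg_split [of "\<rho> n"] pos_add_zero [of "\<rho> n"] \<rho> by simp
  moreover have "pos (pos (\<sim> \<rho> n) \<boxplus> \<sim> pos (\<rho> n)) = pos (\<sim> \<rho> n)"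
    using pos_neg_split [of "\<sim> \<rho> n"] pos_add_zero [of "\<sim> \<rho> n"] \<rho> by simp
  ultimately show ?case using \<rho> by (simp add: e_def parts_def pos_sub)
next
  case (Oplus t u)
  define x y where xy: "x = eval A \<rho> t" "y = eval A \<rho> u"
  have C: "x \<in> car A" "y \<in> car A" using eval_closed \<rho> by (auto simp: xy)
  have "\<sim> (x \<boxplus> y) = (pos (\<sim> x) \<boxplus> pos (\<sim> y)) \<boxplus> \<sim> (pos x \<boxplus> pos y)"
    using split_pos [of x y] C by (simp add: neg_add comm)
  thus ?case using Oplus split_pos [of x y] C by (simp add: e_def pos_sub flip: xy)
next
  case (Mn t)
  thus ?case using eval_closed [of \<rho> t] \<rho> by (simp add: e_def mns_eq_neg_pos)
qed (use \<rho> eval_closed [of \<rho>] in \<open>simp_all add: e_def\<close>)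

text \<open>Equality is reached only after adding 0, because the two parts do not distinguish
  \<open>x\<close> from \<open>x\<close> plus 0.\<close>

lemma eval_eq_of_real_valid:
  assumes \<rho>: "\<And>n. \<rho> n \<in> car A"
    and valid: "real_valid (fst (mv_translation t)) (fst (mv_translation s))" "real_valid (snd (mv_translation t)) (snd (mv_translation s))"
  shows "eval A \<rho> t \<boxplus> \<^bold>0 = eval A \<rho> s \<boxplus> \<^bold>0"
proof -
  have "range (parts \<rho>) \<subseteq> positive" using \<rho> by (auto simp: parts_def)
  hence "pos (eval A \<rho> t) = pos (eval A \<rho> s)" "pos (\<sim> eval A \<rho> t) = pos (\<sim> eval A \<rho> s)"
    using P.chang_completeness [of "parts \<rho>", OF _ valid(1)] P.chang_completeness [of "parts \<rho>", OF _ valid(2)]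
      eval_translation [of \<rho> t] eval_translation [of \<rho> s] \<rho> by simp_all
  thus ?thesis
    using pos_neg_split [of "eval A \<rho> t"] pos_neg_split [of "eval A \<rho> s"] eval_closed [of \<rho>] \<rho> by simp
qed

end

text \<open>The right side is a truncated difference of two truncated sums. With equal signs the
  second or the first sum is 0; with opposite signs neither sum is truncated.\<close>

lemma max_zero_clip_add:
  assumes "\<bar>x\<bar> \<le> 1" "\<bar>y\<bar> \<le> 1"
  shows "max 0 (clip (x + y)) = 1 - min 1 (1 - min 1 (max 0 x + max 0 y) + min 1 (max 0 (- x) + max 0 (- y)))"
  using assms by (cases "0 \<le> x"; cases "0 \<le> y") (auto simp: clip_def)

text \<open>Real counterpart of \<open>eval_translation\<close>. A variable receives the difference
  of its two MV-variables, so every assignment in the unit interval is matched by one in the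
  square.\<close>

lemma real_eval_translationanslation:
  assumes \<tau>: "\<And>n. 0 \<le> \<tau> n \<and> \<tau> n \<le> 1"
  defines "\<rho> \<equiv> \<lambda>n. (\<tau> (2 * n) - \<tau> (2 * n + 1), 0)"
  shows "real_eval \<tau> (fst (mv_translation t)) = max 0 (fst (eval Sstar \<rho> t)) \<and>
    real_eval \<tau> (snd (mv_translation t)) = max 0 (- fst (eval Sstar \<rho> t))"
proof (induction t)
  case (Var n)
  show ?case using \<tau> [of "2 * n"] \<tau> [of "2 * n + 1"] by (auto simp: \<rho>_def)
next
  case (Oplus t u)
  have \<rho>: "\<rho> n \<in> car Sstar" for n
    using \<tau> [of "2 * n"] \<tau> [of "2 * n + 1"] by (auto simp: \<rho>_def)
  define x y where xy: "x = fst (eval Sstar \<rho> t)" "y = fst (eval Sstar \<rho> u)"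
  have bounds: "\<bar>x\<bar> \<le> 1" "\<bar>y\<bar> \<le> 1"
    using eval_Sstar_car [of \<rho> t, OF \<rho>] eval_Sstar_car [of \<rho> u, OF \<rho>] by (auto simp: xy)
  have "- clip (x + y) = clip (- x + - y)" by (simp add: clip_def)
  hence "max 0 (- clip (x + y)) = 1 - min 1 (1 - min 1 (max 0 (- x) + max 0 (- y)) + min 1 (max 0 x + max 0 y))"
    using max_zero_clip_add [of "- x" "- y"] bounds by (simp only: abs_minus_cancel minus_minus)
  thus ?case
    using max_zero_clip_add [OF bounds] Oplus
    by (simp only: mv_translation.simps mv_eval.simps eval.simps Sstar_simps fst_conv snd_conv simp_thms flip: xy)
next
  case (Neg t)
  thus ?case by (simp only: mv_translation.simps eval.simps Sstar_simps fst_conv fst_swap snd_swap minus_minus simp_thms)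
next
  case (Pl t)
  have "max 0 (max 0 r) = max 0 r" "max 0 (- max 0 r) = 0" for r :: real by auto
  thus ?case using Pl by (simp only: mv_translation.simps eval.simps mv_eval.simps Sstar_simps fst_conv snd_conv simp_thms)
next
  case (Mn t)
  have "max 0 (min 0 r) = 0" "max 0 (- min 0 r) = max 0 (- r)" for r :: real by auto
  thus ?case using Mn by (simp only: mv_translation.simps eval.simps mv_eval.simps Sstar_simps fst_conv snd_conv simp_thms)
qed auto

lemma real_valid_translation:
  assumes "holds Sstar t s"
  shows "real_valid (fst (mv_translation t)) (fst (mv_translation s))" "real_valid (snd (mv_translation t)) (snd (mv_translation s))"
proof -
  have "real_eval \<tau> (fst (mv_translation t)) = real_eval \<tau> (fst (mv_translation s)) \<and> real_eval \<tau> (snd (mv_translation t)) = real_eval \<tau> (snd (mv_translation s))"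
    if \<tau>: "\<forall>n. 0 \<le> \<tau> n \<and> \<tau> n \<le> 1" for \<tau>
  proof -
    define \<rho> where "\<rho> n = (\<tau> (2 * n) - \<tau> (2 * n + 1), 0 :: real)" for n
    have "\<rho> n \<in> car Sstar" for n
      using \<tau> [THEN spec, of "2 * n"] \<tau> [THEN spec, of "2 * n + 1"] by (auto simp: \<rho>_def)
    hence "eval Sstar \<rho> t = eval Sstar \<rho> s" using assms unfolding holds_def by blast
    moreover have "real_eval \<tau> (fst (mv_translation u)) = max 0 (fst (eval Sstar \<rho> u))"
      "real_eval \<tau> (snd (mv_translation u)) = max 0 (- fst (eval Sstar \<rho> u))" for u
      using real_eval_translationanslation [of \<tau> u] \<tau> unfolding \<rho>_def by blast+
    ultimately show ?thesis by simp
  qed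
  thus "real_valid (fst (mv_translation t)) (fst (mv_translation s))" "real_valid (snd (mv_translation t)) (snd (mv_translation s))"
    by (auto simp: real_valid_def)
qed

section \<open>Regular terms and variables under iterated negation\<close>

primrec regular :: "tm \<Rightarrow> bool" where
  "regular (Var n) = False"
| "regular Zero = True"
| "regular One = True"
| "regular (Oplus t u) = True"
| "regular (Neg t) = regular t"
| "regular (Pl t) = True"
| "regular (Mn t) = True"

lemma (in sqmv_algebra) eval_regular:
  assumes \<rho>: "\<And>n. \<rho> n \<in> car A"
  shows "regular t \<Longrightarrow> eval A \<rho> t \<boxplus> \<^bold>0 = eval A \<rho> t"
proof (induction t)
  case (Neg t)
  thus ?case using neg_add [of "eval A \<rho> t" "\<^bold>0"] eval_closed [of \<rho> t] \<rho> by simp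
next
  case (Mn t)
  thus ?case using eval_closed [of \<rho> t] \<rho> by (simp add: mns_eq)
qed (use eval_closed [of \<rho>] \<rho> in auto)


text \<open>The variable and the sign of a non-regular term; meaningless on regular terms.\<close>

primrec literal :: "tm \<Rightarrow> nat \<times> bool" where
  "literal (Var n) = (n, True)"
| "literal Zero = undefined"
| "literal One = undefined"
| "literal (Oplus t u) = undefined"
| "literal (Neg t) = (fst (literal t), \<not> snd (literal t))"
| "literal (Pl t) = undefined"
| "literal (Mn t) = undefined"

lemma eval_not_regular:
  assumes "\<And>n. ng A (ng A (\<rho> n)) = \<rho> n"
  shows "\<not> regular t \<Longrightarrow> eval A \<rho> t = (if snd (literal t) then \<rho> (fst (literal t)) else ng A (\<rho> (fst (literal t))))"
  using assms by (induction t) auto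

text \<open>Negation preserves a zero second coordinate; the constants and all other operations
  produce one.\<close>

lemma eval_Sstar_regular: "regular t \<Longrightarrow> snd (eval Sstar \<rho> t) = 0"
  by (induction t) auto

lemma holds_Sstar_regular_iff:
  assumes "holds Sstar t s"
  shows "regular t \<longleftrightarrow> regular s" and "\<not> regular t \<Longrightarrow> literal t = literal s"
proof -
  have nn: "ng Sstar (ng Sstar p) = p" for p by simp
  \<comment> \<open>All second coordinates are nonzero, which detects non-regular terms; the sign
    gives the parity of negations, and 1 against 1/2 singles out variable \<open>n\<close>.\<close>
  define \<rho> :: "nat \<Rightarrow> nat \<Rightarrow> real \<times> real" where "\<rho> n m = (0, if m = n then 1 else 1/2)" for n m
  have eq: "eval Sstar (\<rho> n) t = eval Sstar (\<rho> n) s" for n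
    using assms unfolding holds_def by (auto simp: \<rho>_def)
  have val: "snd (eval Sstar (\<rho> n) u) = (if snd (literal u) then 1 else -1) * (if fst (literal u) = n then 1 else 1/2)"
    if "\<not> regular u" for n u
    using eval_not_regular [of Sstar "\<rho> n" u] nn that by (auto simp: \<rho>_def)
  have reg: "snd (eval Sstar (\<rho> n) u) = 0" if "regular u" for n u
    using that by (rule eval_Sstar_regular)
  have nz: "snd (eval Sstar (\<rho> 0) u) \<noteq> 0" if "\<not> regular u" for u
    using val [OF that, of 0] by simp
  show iff: "regular t \<longleftrightarrow> regular s"
    using nz [of t] nz [of s] reg [of t 0] reg [of s 0] eq [of 0] by metis
  show "literal t = literal s" if "\<not> regular t"
    using val [of t "fst (literal t)"] val [of s "fst (literal t)"] eq [of "fst (literal t)"] that iff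
    by (auto simp: prod_eq_iff split: if_splits)
qed

text \<open>Regular terms absorb the added 0, so equal parts give equal values. Non-regular terms
  share their literal and agree by double negation alone.\<close>

theorem holds_of_holds_Sstar:
  fixes A :: "('a, 'b) qalg_scheme"
  assumes "is_sqmv A" "holds Sstar t s"
  shows "holds A t s"
  unfolding holds_def
proof (intro allI impI)
  interpret sqmv_algebra A by unfold_locales fact
  fix \<rho> :: "nat \<Rightarrow> 'a"
  assume \<rho>: "\<forall>n. \<rho> n \<in> car A"
  show "eval A \<rho> t = eval A \<rho> s"
  proof (cases "regular t")
    case True
    hence "regular s" using holds_Sstar_regular_iff(1) [OF assms(2)] by blast
    have "eval A \<rho> t = eval A \<rho> t \<boxplus> \<^bold>0"
      using eval_regular [of \<rho> t] \<rho> True by metis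
    also have "\<dots> = eval A \<rho> s \<boxplus> \<^bold>0"
      by (rule eval_eq_of_real_valid [OF _ real_valid_translation [OF assms(2)]]) (use \<rho> in blast)
    also have "\<dots> = eval A \<rho> s"
      using eval_regular [of \<rho> s] \<rho> \<open>regular s\<close> by metis
    finally show ?thesis .
  next
    case False
    have "ng A (ng A (\<rho> n)) = \<rho> n" for n using \<rho> by simp
    hence "eval A \<rho> u = (if snd (literal u) then \<rho> (fst (literal u)) else ng A (\<rho> (fst (literal u))))"
      if "\<not> regular u" for u
      using eval_not_regular that by blast
    thus ?thesis
      using False holds_Sstar_regular_iff [OF assms(2)] by metis
  qed
qed

theorem theorem3p1:
  fixes t s :: tm
  shows "SQMV_holds TYPE('a::infinite) t s \<longleftrightarrow> holds Sstar t s"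
  using holds_Sstar_of_SQMV_holds holds_of_holds_Sstar unfolding SQMV_holds_def by blast

end
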